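(* Let $\Omega \subset \mathbb{R}^N$, $N\geq 2$, be open, bounded, convex, with $\partial \Omega \in C^{1,\alpha}$, $\alpha\in(0,1)$, and let $p\in (1,+\infty)$. Assume $a \in L^{\infty}(\Omega)$. Let $a_{\infty} \in (0,+\infty)$ be a constant and let $u_{\infty}$ be a positive solution of $$-\Delta_p u_{\infty} = a_{\infty} \ \text{ in } \Omega,\qquad u_{\infty} =0 \ \text{ on } \partial \Omega.$$ Then the solution $u \in C^{0,\beta}(\overline{\Omega})$, $\beta \in (0,1]$, of $$-\Delta_p u = a(x) \ \text{ in } \Omega,\qquad u>0 \ \text{ in } \Omega,\qquad u =0 \ \text{ on } \partial \Omega$$ satisfies $$\big\|u^{\frac{p-1}{p}}-u_{\infty}^{\frac{p-1}{p}}\big\|_{\infty} \leq C \|a -a_{\infty}\|_{\infty}^{\kappa}$$ for some $C=C(p, \Omega, a_{\infty}, \alpha, \|a\|_{\infty})>0$ and some $\kappa =\kappa(p, N, \beta) \in (0,1)$.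
   Context: $\Delta_p u=\mathrm{div}(|\nabla u|^{p-2}\nabla u)$; "solution" means weak solution in $W^{1,p}_0(\Omega)$; $\|\cdot\|_\infty$ is the $L^\infty(\Omega)$ norm. *)

theory Defs
  imports "HOL-Analysis.Analysis" "HOL-Probability.Essential_Supremum"
begin

definition grad :: "('a::euclidean_space \<Rightarrow> real) \<Rightarrow> 'a \<Rightarrow> 'a" where
  "grad f x = (\<Sum>b\<in>Basis. frechet_derivative f (at x) b *\<^sub>R b)"

text \<open>Unfolding the recursion: all partial derivatives of order less than \<open>k\<close> are
  differentiable and those of order \<open>k\<close> are continuous.\<close>

primrec Ck :: "nat \<Rightarrow> ('a::euclidean_space \<Rightarrow> real) \<Rightarrow> bool" where
  "Ck 0 f \<longleftrightarrow> continuous_on UNIV f"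
| "Ck (Suc k) f \<longleftrightarrow> f differentiable_on UNIV \<and>
     (\<forall>b\<in>Basis. Ck k (\<lambda>x. frechet_derivative f (at x) b))"

definition test_functions :: "'a::euclidean_space set \<Rightarrow> ('a \<Rightarrow> real) set" where
  "test_functions \<Omega> =
     {\<phi>. (\<forall>k. Ck k \<phi>) \<and> compact (closure {x. \<phi> x \<noteq> 0}) \<and> closure {x. \<phi> x \<noteq> 0} \<subseteq> \<Omega>}"

definition Lp :: "real \<Rightarrow> 'a::euclidean_space set \<Rightarrow> ('a \<Rightarrow> 'b::euclidean_space) set" where
  "Lp p \<Omega> = {f. f \<in> borel_measurable (lebesgue_on \<Omega>) \<and>
                integrable (lebesgue_on \<Omega>) (\<lambda>x. norm (f x) powr p)}"

text \<open>The essential supremum is taken in \<open>ennreal\<close>; since \<open>enn2real \<infinity> = 0\<close>, the number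
  \<open>Linf_norm \<Omega> f\<close> is meaningful only for \<open>f \<in> Linf \<Omega>\<close>.\<close>

definition Linf :: "'a::euclidean_space set \<Rightarrow> ('a \<Rightarrow> real) set" where
  "Linf \<Omega> = {f. f \<in> borel_measurable (lebesgue_on \<Omega>) \<and>
               esssup (lebesgue_on \<Omega>) (\<lambda>x. ennreal \<bar>f x\<bar>) < \<infinity>}"

definition Linf_norm :: "'a::euclidean_space set \<Rightarrow> ('a \<Rightarrow> real) \<Rightarrow> real" where
  "Linf_norm \<Omega> f = enn2real (esssup (lebesgue_on \<Omega>) (\<lambda>x. ennreal \<bar>f x\<bar>))"

definition has_weak_gradient ::
    "'a::euclidean_space set \<Rightarrow> ('a \<Rightarrow> real) \<Rightarrow> ('a \<Rightarrow> 'a) \<Rightarrow> bool" where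
  "has_weak_gradient \<Omega> u G \<longleftrightarrow>
     (\<forall>K. compact K \<and> K \<subseteq> \<Omega> \<longrightarrow> u absolutely_integrable_on K \<and> G absolutely_integrable_on K) \<and>
     (\<forall>\<phi>\<in>test_functions \<Omega>.
        (\<integral>x. u x *\<^sub>R grad \<phi> x \<partial>lebesgue_on \<Omega>) = - (\<integral>x. \<phi> x *\<^sub>R G x \<partial>lebesgue_on \<Omega>))"

text \<open>Weak gradients on an open set are determined up to a null set, so the choice does not
  affect the Sobolev norm or the weak formulation of the equation.\<close>

definition weak_grad :: "'a::euclidean_space set \<Rightarrow> ('a \<Rightarrow> real) \<Rightarrow> 'a \<Rightarrow> 'a" where
  "weak_grad \<Omega> u = (SOME G. has_weak_gradient \<Omega> u G)"

definition W1p :: "real \<Rightarrow> 'a::euclidean_space set \<Rightarrow> ('a \<Rightarrow> real) set" where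
  "W1p p \<Omega> = {u \<in> Lp p \<Omega>. \<exists>G \<in> Lp p \<Omega>. has_weak_gradient \<Omega> u G}"

definition W1p_norm :: "real \<Rightarrow> 'a::euclidean_space set \<Rightarrow> ('a \<Rightarrow> real) \<Rightarrow> real" where
  "W1p_norm p \<Omega> u =
     ((\<integral>x. \<bar>u x\<bar> powr p \<partial>lebesgue_on \<Omega>) +
      (\<integral>x. norm (weak_grad \<Omega> u x) powr p \<partial>lebesgue_on \<Omega>)) powr (1 / p)"

definition W1p_0 :: "real \<Rightarrow> 'a::euclidean_space set \<Rightarrow> ('a \<Rightarrow> real) set" where
  "W1p_0 p \<Omega> = {u \<in> W1p p \<Omega>. \<exists>\<phi>. (\<forall>k::nat. \<phi> k \<in> test_functions \<Omega>) \<and>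
                  (\<lambda>k. W1p_norm p \<Omega> (\<lambda>x. u x - \<phi> k x)) \<longlonglongrightarrow> 0}"

text \<open>Weak solutions in \<open>W1p_0 p \<Omega>\<close> of \<open>- div (|\<nabla>u|\<^sup>p\<^sup>-\<^sup>2 \<nabla>u) = f\<close> in \<open>\<Omega>\<close>, \<open>u = 0\<close> on the
  boundary. For \<open>p < 2\<close> the flux is 0 where the gradient vanishes.\<close>

definition p_Laplace_solution ::
    "real \<Rightarrow> 'a::euclidean_space set \<Rightarrow> ('a \<Rightarrow> real) \<Rightarrow> ('a \<Rightarrow> real) \<Rightarrow> bool" where
  "p_Laplace_solution p \<Omega> f u \<longleftrightarrow> u \<in> W1p_0 p \<Omega> \<and>
     (\<forall>\<phi>\<in>test_functions \<Omega>.
        (\<integral>x. (norm (weak_grad \<Omega> u x) powr (p - 2) *\<^sub>R weak_grad \<Omega> u x) \<bullet> grad \<phi> x \<partial>lebesgue_on \<Omega>)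
        = (\<integral>x. f x * \<phi> x \<partial>lebesgue_on \<Omega>))"

definition Holder_on ::
    "real \<Rightarrow> 'a::metric_space set \<Rightarrow> ('a \<Rightarrow> 'b::metric_space) \<Rightarrow> bool" where
  "Holder_on \<beta> S f \<longleftrightarrow> (\<exists>L. \<forall>x\<in>S. \<forall>y\<in>S. dist (f x) (f y) \<le> L * dist x y powr \<beta>)"

text \<open>Near each boundary point, in suitable Cartesian coordinates with last axis \<open>e\<close>, the set
  is the part of a ball above the graph of a \<open>C\<^sup>1\<^sup>,\<^sup>\<alpha>\<close> function of the other coordinates. These
  are encoded by the projection \<open>x - (x \<bullet> e) e\<close> onto the hyperplane orthogonal to \<open>e\<close>; a function
  on the hyperplane is identified with its extension constant in direction \<open>e\<close>.\<close>

definition C1_alpha_boundary :: "real \<Rightarrow> 'a::euclidean_space set \<Rightarrow> bool" where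
  "C1_alpha_boundary \<alpha> \<Omega> \<longleftrightarrow>
     (\<forall>x0\<in>frontier \<Omega>. \<exists>r>0. \<exists>e \<gamma>. norm e = 1 \<and>
        \<gamma> differentiable_on UNIV \<and> Holder_on \<alpha> UNIV (grad \<gamma>) \<and>
        \<Omega> \<inter> ball x0 r = {x \<in> ball x0 r. x \<bullet> e > \<gamma> (x - (x \<bullet> e) *\<^sub>R e)})"

end

theory Submission
  imports Defs
begin

text \<open>The estimate comes from the homogeneity of the p-Laplacian and a comparison principle. If
\<open>w\<close> solves \<open>- \<Delta>\<^sub>p w = h\<close> with a constant \<open>h > 0\<close>, then \<open>c w\<close> solves the equation with
right-hand side \<open>c\<^sup>p\<^sup>-\<^sup>1 h\<close>. So if \<open>\<bar>a - h\<bar> \<le> t h\<close> almost everywhere, a solution \<open>u\<close> for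
\<open>a\<close> lies below \<open>(1 + t)\<^bsup>1/(p-1)\<^esup> w\<close> and, when \<open>t < 1\<close>, above \<open>(1 - t)\<^bsup>1/(p-1)\<^esup> w\<close>. Raising
to the power \<open>q = (p-1)/p\<close> turns the factors into \<open>(1 \<plusminus> t)\<^bsup>1/p\<^esup>\<close>, which lie between
\<open>1 - t\<close> and \<open>1 + t\<close>; hence \<open>\<bar>u\<^sup>q - w\<^sup>q\<bar> \<le> t w\<^sup>q\<close> (\<open>p_Laplace_relative_stability\<close>). With
\<open>w\<close> bounded by a constant depending only on \<open>p\<close>, \<open>h\<close> and \<open>\<Omega>\<close> (\<open>p_torsion_bounded\<close>), this
is a linear bound in \<open>\<delta> = \<parallel>a - h\<parallel>\<^sub>\<infinity>\<close>. Since \<open>\<delta> \<le> \<parallel>a\<parallel>\<^sub>\<infinity> + h\<close>, linear growth is dominated by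
a multiple of \<open>\<delta>\<^bsup>1/2\<^esup>\<close>, and \<open>\<kappa> = 1/2\<close> serves every \<open>\<beta>\<close>.

The comparison principle (\<open>weak_comparison\<close>) is the standard one: test the difference of
the two equations with a nondecreasing function of \<open>u - v\<close> that vanishes for \<open>u \<le> v\<close>;
strict monotonicity of \<open>\<xi> \<mapsto> \<bar>\<xi>\<bar>\<^sup>p\<^sup>-\<^sup>2 \<xi>\<close> then gives \<open>\<nabla>u = \<nabla>v\<close> where \<open>u > v\<close>. Everything is
done on approximating smooth functions, so that no chain rule or lattice structure of
Sobolev spaces enters. The nondecreasing function is \<open>H(s) = exp (-1/s)\<close> for \<open>s > 0\<close> and
\<open>0\<close> otherwise: it is smooth, so if \<open>\<phi>\<^sub>k \<rightarrow> u\<close> and \<open>\<eta>\<^sub>k \<rightarrow> v\<close> are smooth approximations with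
\<open>\<phi>\<^sub>k \<le> \<eta>\<^sub>k\<close> off a compact subset of \<open>\<Omega>\<close>, then \<open>H (\<phi>\<^sub>k - \<eta>\<^sub>k)\<close> is a test function. Passing
to subsequences whose gradients are dominated by one function in \<open>L\<^sup>p\<close>
(\<open>W1p_0_dominated_approx\<close>) reduces all limits to dominated convergence. The gradients of
\<open>H (\<phi>\<^sub>k - \<eta>\<^sub>k)\<close> tend to \<open>0\<close> in \<open>L\<^sup>1\<close>, and the \<open>L\<^sup>1\<close> Poincare inequality for nonnegative
test functions, a single integration by parts, yields \<open>H (u - v) = 0\<close>.

Since \<open>weak_grad\<close> is a choice among weak gradients, the approximation needs their
uniqueness; it follows because products of rescaled copies of \<open>H\<close> approximate indicator
functions of boxes (\<open>AE_eq_0_if_orthogonal_to_test_functions\<close>).\<close>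

section \<open>Closure properties of smooth functions\<close>

lemma Ck_const [simp]: "Ck k (\<lambda>x. c)"
  by (induction k arbitrary: c) (auto simp: differentiable_on_def)

lemma Ck_mono_Suc: "Ck (Suc k) f \<Longrightarrow> Ck k f"
proof (induction k arbitrary: f)
  case 0
  then show ?case by (auto intro: differentiable_imp_continuous_on)
next
  case (Suc k)
  then show ?case by auto
qed

lemma Ck_SucI:
  assumes "\<And>x. (f has_derivative f' x) (at x)" and "\<And>b. b \<in> Basis \<Longrightarrow> Ck k (\<lambda>x. f' x b)"
  shows "Ck (Suc k) f"
proof -
  have "frechet_derivative f (at x) = f' x" for x
    using assms(1)[of x] frechet_derivative_at by metis
  moreover have "f differentiable_on UNIV"
    using assms(1) by (auto simp: differentiable_on_def differentiable_def)
  ultimately show ?thesis using assms(2) by simp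
qed

lemma Ck_Suc_has_derivative:
  assumes "Ck (Suc k) f"
  shows "(f has_derivative frechet_derivative f (at x)) (at x)"
  using assms frechet_derivative_works by (auto simp: differentiable_on_def)

lemma Ck_add: "Ck k f \<Longrightarrow> Ck k g \<Longrightarrow> Ck k (\<lambda>x. f x + g x)"
proof (induction k arbitrary: f g)
  case 0
  then show ?case by (auto intro: continuous_intros)
next
  case (Suc k)
  show ?case
    by (rule Ck_SucI[OF has_derivative_add[OF Ck_Suc_has_derivative[OF Suc.prems(1)] Ck_Suc_has_derivative[OF Suc.prems(2)]]])
       (use Suc in auto)
qed

lemma Ck_mult: "Ck k f \<Longrightarrow> Ck k g \<Longrightarrow> Ck k (\<lambda>x. f x * g x)"
proof (induction k arbitrary: f g)
  case 0
  then show ?case by (auto intro: continuous_intros)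
next
  case (Suc k)
  have "Ck k f" "Ck k g" using Suc.prems Ck_mono_Suc by blast+
  then show ?case
    by (intro Ck_SucI[OF has_derivative_mult[OF Ck_Suc_has_derivative[OF Suc.prems(1)] Ck_Suc_has_derivative[OF Suc.prems(2)]]])
       (use Suc in \<open>auto intro!: Ck_add\<close>)
qed

lemma Ck_diff: "Ck k f \<Longrightarrow> Ck k g \<Longrightarrow> Ck k (\<lambda>x. f x - g x)"
  using Ck_add[of k f "\<lambda>x. (-1) * g x"] Ck_mult[of k "\<lambda>x. -1" g] by simp

lemma Ck_prod: "finite A \<Longrightarrow> (\<And>i. i \<in> A \<Longrightarrow> Ck k (f i)) \<Longrightarrow> Ck k (\<lambda>x. \<Prod>i\<in>A. f i x)"
  by (induction A rule: finite_induct) (auto intro!: Ck_mult)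

lemma Ck_inner: "Ck k (\<lambda>x. x \<bullet> b)"
proof (cases k)
  case 0
  then show ?thesis by (auto intro!: continuous_intros)
next
  case (Suc m)
  show ?thesis unfolding Suc
    by (rule Ck_SucI[where f' = "\<lambda>x y. y \<bullet> b"]) (auto intro!: derivative_eq_intros)
qed

lemma Ck_exp: "Ck k f \<Longrightarrow> Ck k (\<lambda>x. exp (f x))"
proof (induction k arbitrary: f)
  case 0
  then show ?case by (auto intro: continuous_intros)
next
  case (Suc k)
  have "((\<lambda>x. exp (f x)) has_derivative (\<lambda>y. frechet_derivative f (at x) y * exp (f x))) (at x)" for x
    using has_derivative_exp[OF Ck_Suc_has_derivative[OF Suc.prems(1)]] by (simp add: mult.commute)
  then show ?case
    by (rule Ck_SucI) (use Suc Ck_mono_Suc in \<open>auto intro!: Ck_mult\<close>)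
qed

section \<open>A smooth function that is flat on the negative half-line\<close>

text \<open>The family is closed under differentiation up to linear combinations, so smoothness of
\<open>flat 0\<close> and of its compositions follows by one induction that is simultaneous in \<open>m\<close>.\<close>

definition flat :: "nat \<Rightarrow> real \<Rightarrow> real" where
  "flat m s = (if s > 0 then (1/s) ^ m * exp (- (1/s)) else 0)"

lemma flat_at_right_0: "(flat m \<longlongrightarrow> 0) (at_right 0)"
proof -
  have "((\<lambda>s::real. inverse s ^ m / exp (inverse s)) \<longlongrightarrow> 0) (at_right 0)"
    by (rule filterlim_compose[OF tendsto_power_div_exp_0 filterlim_inverse_at_top_right])
  moreover have "eventually (\<lambda>s. inverse s ^ m / exp (inverse s) = flat m s) (at_right 0)"
    by (auto simp: eventually_at_right_field flat_def exp_minus field_simps intro!: exI[of _ 1])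
  ultimately show ?thesis by (rule Lim_transform_eventually)
qed

text \<open>At \<open>s = 0\<close> the right difference quotient of \<open>flat m\<close> is \<open>flat (m + 1)\<close>, which tends to \<open>0\<close>
because the exponential beats every power.\<close>

lemma flat_has_derivative:
  "(flat m has_real_derivative flat (m + 2) s - real m * flat (m + 1) s) (at s)"
proof -
  consider "s > 0" | "s < 0" | "s = 0" by linarith
  then show ?thesis
  proof cases
    case 1
    have d: "((\<lambda>s. 1/s) has_real_derivative - ((1/s)\<^sup>2)) (at s)"
      using 1 by (auto intro!: derivative_eq_intros simp: power2_eq_square)
    have "((\<lambda>s. (1/s) ^ m * exp (- (1/s))) has_real_derivative flat (m + 2) s - real m * flat (m + 1) s) (at s)"
      by (rule DERIV_cong[OF DERIV_mult[OF DERIV_power[OF d] DERIV_chain2[OF DERIV_exp DERIV_minus[OF d]]]])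
        (use 1 in \<open>cases m; simp add: flat_def algebra_simps power2_eq_square\<close>)
    moreover have "\<forall>\<^sub>F t in nhds s. flat m t = (1/t) ^ m * exp (- (1/t))"
      using eventually_gt_at_top 1 eventually_nhds_in_open[of "{0<..}" s]
      by (auto simp: flat_def elim!: eventually_mono)
    ultimately show ?thesis by (subst DERIV_cong_ev[OF refl _ refl]) auto
  next
    case 2
    have "\<forall>\<^sub>F t in nhds s. flat m t = 0"
      using 2 eventually_nhds_in_open[of "{..<0}" s]
      by (auto simp: flat_def elim!: eventually_mono)
    then show ?thesis using 2 by (subst DERIV_cong_ev[OF refl _ refl]) (auto simp: flat_def)
  next
    case 3
    have r: "((\<lambda>t. (flat m t - flat m 0) / (t - 0)) \<longlongrightarrow> 0) (at_right 0)"
    proof (rule Lim_transform_eventually[OF flat_at_right_0[of "m+1"]])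
      show "\<forall>\<^sub>F t in at_right 0. flat (m + 1) t = (flat m t - flat m 0) / (t - 0)"
        by (auto simp: eventually_at_right_field flat_def field_simps intro!: exI[of _ 1])
    qed
    have l: "((\<lambda>t. (flat m t - flat m 0) / (t - 0)) \<longlongrightarrow> 0) (at_left 0)"
    proof (rule Lim_transform_eventually[OF tendsto_const])
      show "\<forall>\<^sub>F t in at_left 0. 0 = (flat m t - flat m 0) / (t - 0)"
        by (auto simp: eventually_at_left_field flat_def intro!: exI[of _ "-1"])
    qed
    show ?thesis using 3 filterlim_split_at[OF l r] 
      by (simp add: has_field_derivative_iff flat_def)
  qed
qed

lemma flat_continuous: "continuous_on S (flat m)"
  using flat_has_derivative DERIV_isCont continuous_at_imp_continuous_on by blast

lemma flat_compose_has_derivative: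
  assumes "(f has_derivative f') (at x)"
  shows "((\<lambda>x. flat m (f x)) has_derivative (\<lambda>y. (flat (m + 2) (f x) - real m * flat (m + 1) (f x)) * f' y)) (at x)"
  using has_derivative_compose[OF assms flat_has_derivative[unfolded has_field_derivative_def]] .

lemma Ck_flat: "Ck k f \<Longrightarrow> Ck k (\<lambda>x. flat m (f x))"
proof (induction k arbitrary: m)
  case 0
  then show ?case using continuous_on_compose2[OF flat_continuous[of UNIV m]] by auto
next
  case (Suc k)
  note [simp] = Suc.IH[OF Ck_mono_Suc[OF Suc.prems]]
  show ?case
    by (rule Ck_SucI[OF flat_compose_has_derivative[OF Ck_Suc_has_derivative[OF Suc.prems]]])
      (use Suc.prems in \<open>auto intro!: Ck_mult Ck_diff\<close>)
qed

lemma flat_nonneg: "0 \<le> flat m s"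
  by (simp add: flat_def)

lemma flat_eq_0_iff: "flat m s = 0 \<longleftrightarrow> s \<le> 0"
  by (simp add: flat_def)

lemma flat_0_le_1: "flat 0 s \<le> 1"
  by (simp add: flat_def)

text \<open>As \<open>flat 2\<close> is the derivative of \<open>flat 0\<close>, this bounds the gradients of truncations. It
holds since \<open>y\<^sup>2 \<le> 2 exp y\<close> for \<open>y = 1/s\<close>.\<close>

lemma flat_2_le_2: "flat 2 s \<le> 2"
proof (cases "s > 0")
  case True
  have "1 + 1/s + (1/s)^2/2 \<le> exp (1/s)" 
    using exp_lower_Taylor_quadratic[of "1/s"] True by auto
  then have "(1/s)^2 \<le> 2 * exp (1/s)"
    using True by (smt (verit) zero_less_divide_1_iff field_sum_of_halves)
  then have "(1/s)^2 * exp (- (1/s)) \<le> 2 * exp (1/s) * exp (- (1/s))"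
    by (rule mult_right_mono) simp
  also have "\<dots> = 2" by (simp add: exp_minus)
  finally show ?thesis using True by (simp add: flat_def)
qed (simp add: flat_def)

lemma flat_0_rescaled_tendsto: "(\<lambda>n. flat 0 (real n * s)) \<longlonglongrightarrow> indicator {0<..} s"
proof (cases "s > 0")
  case True
  have "(\<lambda>n. exp (- (inverse (real n) * inverse s))) \<longlonglongrightarrow> exp (- (0 * inverse s))"
    by (intro tendsto_intros lim_inverse_n)
  moreover have "\<forall>\<^sub>F n in sequentially. exp (- (inverse (real n) * inverse s)) = flat 0 (real n * s)"
    using eventually_gt_at_top[of 0] by eventually_elim (use True in \<open>auto simp: flat_def field_simps\<close>)
  ultimately show ?thesis using True by (auto intro: Lim_transform_eventually)
qed (auto simp: flat_def zero_less_mult_iff)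

section \<open>Gradients, test functions and integration by parts\<close>

abbreviation smooth :: "('a::euclidean_space \<Rightarrow> real) \<Rightarrow> bool" where
  "smooth f \<equiv> \<forall>k. Ck k f"

lemma grad_inner_Basis: "b \<in> Basis \<Longrightarrow> grad f x \<bullet> b = frechet_derivative f (at x) b"
  by (simp add: grad_def inner_sum_left inner_Basis if_distrib cong: if_cong)

lemma grad_eqI:
  assumes "(f has_derivative (\<lambda>y. v \<bullet> y)) (at x)"
  shows "grad f x = v"
proof (rule euclidean_eqI)
  fix b :: 'a assume "b \<in> Basis"
  then show "grad f x \<bullet> b = v \<bullet> b"
    using frechet_derivative_at[OF assms] by (metis grad_inner_Basis)
qed

lemma C1_has_derivative_grad:
  assumes "Ck (Suc k) f"
  shows "(f has_derivative (\<lambda>y. grad f x \<bullet> y)) (at x)"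
proof -
  have l: "(f has_derivative frechet_derivative f (at x)) (at x)"
    by (rule Ck_Suc_has_derivative[OF assms])
  have "frechet_derivative f (at x) y = grad f x \<bullet> y" for y
  proof -
    have "frechet_derivative f (at x) y = frechet_derivative f (at x) (\<Sum>b\<in>Basis. (y \<bullet> b) *\<^sub>R b)"
      by (simp add: euclidean_representation)
    also have "\<dots> = (\<Sum>b\<in>Basis. (y \<bullet> b) *\<^sub>R frechet_derivative f (at x) b)"
      using l[THEN has_derivative_bounded_linear, THEN bounded_linear.linear]
      by (simp add: linear_sum linear_cmul)
    also have "\<dots> = grad f x \<bullet> y"
      by (simp add: grad_def inner_sum_left inner_commute[of y] mult.commute)
    finally show ?thesis .
  qed
  then have "frechet_derivative f (at x) = (\<lambda>y. grad f x \<bullet> y)" by blast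
  with l show ?thesis by metis
qed

lemma C1_continuous: "Ck (Suc k) f \<Longrightarrow> continuous_on S f"
  by (auto intro: continuous_on_subset[OF differentiable_imp_continuous_on])

lemma C1_continuous_grad:
  assumes "Ck 1 f" shows "continuous_on S (grad f)"
proof -
  have "continuous_on UNIV (grad f)"
    unfolding grad_def using assms by (auto intro!: continuous_intros)
  then show ?thesis by (rule continuous_on_subset) simp
qed

lemma grad_eq_0_off_support:
  assumes "closed K" "\<And>x. x \<notin> K \<Longrightarrow> f x = 0" "x \<notin> K"
  shows "grad f x = 0"
proof (rule grad_eqI)
  have "((\<lambda>x. 0) has_derivative (\<lambda>y. 0 \<bullet> y)) (at x)" by simp
  then show "(f has_derivative (\<lambda>y. 0 \<bullet> y)) (at x)"
    by (rule has_derivative_transform_within_open[of _ _ _ _ "- K"]) (use assms in auto)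
qed

lemma smooth_continuous: "smooth f \<Longrightarrow> continuous_on S f"
  using C1_continuous[of 0] by blast

lemma grad_diff: "Ck 1 f \<Longrightarrow> Ck 1 g \<Longrightarrow> grad (\<lambda>x. f x - g x) x = grad f x - grad g x"
  by (intro grad_eqI) (auto intro!: derivative_eq_intros C1_has_derivative_grad[of 0] simp: inner_diff_left)

lemma grad_mult: "Ck 1 f \<Longrightarrow> Ck 1 g \<Longrightarrow> grad (\<lambda>x. f x * g x) x = f x *\<^sub>R grad g x + g x *\<^sub>R grad f x"
  by (intro grad_eqI) (auto intro!: derivative_eq_intros C1_has_derivative_grad[of 0] simp: inner_add_left)

lemma grad_cmult: "Ck 1 f \<Longrightarrow> grad (\<lambda>x. c * f x) x = c *\<^sub>R grad f x"
  by (intro grad_eqI) (auto intro!: derivative_eq_intros C1_has_derivative_grad[of 0])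

lemma grad_flat_0: "Ck 1 f \<Longrightarrow> grad (\<lambda>x. flat 0 (f x)) x = flat 2 (f x) *\<^sub>R grad f x"
  using flat_compose_has_derivative[OF C1_has_derivative_grad[of 0 f x], of 0]
  by (intro grad_eqI) (simp add: numeral_2_eq_2)

lemma test_functionsI:
  assumes "smooth \<psi>" "compact K" "K \<subseteq> \<Omega>" "\<And>x. x \<notin> K \<Longrightarrow> \<psi> x = 0"
  shows "\<psi> \<in> test_functions \<Omega>"
proof -
  have "closure {x. \<psi> x \<noteq> 0} \<subseteq> K"
    using assms by (intro closure_minimal) (auto simp: compact_imp_closed)
  then show ?thesis
    unfolding test_functions_def using assms
    by (auto simp: compact_eq_bounded_closed intro: bounded_subset)
qed

lemma test_functionsE:
  assumes "\<psi> \<in> test_functions \<Omega>"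
  obtains K where "compact K" "K \<subseteq> \<Omega>" "\<And>x. x \<notin> K \<Longrightarrow> \<psi> x = 0" "\<And>x. x \<notin> K \<Longrightarrow> grad \<psi> x = 0"
proof
  let ?K = "closure {x. \<psi> x \<noteq> 0}"
  show "compact ?K" "?K \<subseteq> \<Omega>" using assms by (auto simp: test_functions_def)
  show *: "\<psi> x = 0" if "x \<notin> ?K" for x using that closure_subset[of "{x. \<psi> x \<noteq> 0}"] by auto
  show "grad \<psi> x = 0" if "x \<notin> ?K" for x
    using * that by (rule grad_eq_0_off_support[rotated]) auto
qed

lemma test_functions_smooth: "\<psi> \<in> test_functions \<Omega> \<Longrightarrow> smooth \<psi>"
  by (simp add: test_functions_def)

lemma
  fixes g :: "'a::euclidean_space \<Rightarrow> 'b::euclidean_space"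
  assumes g: "continuous_on UNIV g" and K: "compact K" "K \<subseteq> \<Omega>" "\<And>x. x \<notin> K \<Longrightarrow> g x = 0" and "open \<Omega>"
  shows compact_support_integrable: "integrable (lebesgue_on \<Omega>) g"
    and compact_support_integrable_lborel: "integrable lborel g"
    and compact_support_integral: "(\<integral>x. g x \<partial>lebesgue_on \<Omega>) = (\<integral>x. g x \<partial>lborel)"
proof -
  have m: "g \<in> borel_measurable borel" using g by (rule borel_measurable_continuous_onI)
  have "integrable lborel (\<lambda>x. indicator K x *\<^sub>R g x)"
    by (rule borel_integrable_compact[OF K(1)]) (rule continuous_on_subset[OF g], simp)
  also have "(\<lambda>x. indicator K x *\<^sub>R g x) = g" using K(3) by (auto simp: indicator_def)
  finally show i: "integrable lborel g" .
  have o: "(\<lambda>x. indicator \<Omega> x *\<^sub>R g x) = g" using K(2,3) by (auto simp: fun_eq_iff split: split_indicator)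
  have s: "\<Omega> \<in> sets lebesgue" using \<open>open \<Omega>\<close> by auto
  show "integrable (lebesgue_on \<Omega>) g"
    using s i m by (simp add: integrable_restrict_space o integrable_completion)
  show "(\<integral>x. g x \<partial>lebesgue_on \<Omega>) = (\<integral>x. g x \<partial>lborel)"
    using s m by (simp add: integral_restrict_space o integral_completion)
qed

text \<open>By translation invariance the difference quotients of \<open>f\<close> in direction \<open>b\<close> have integral
\<open>0\<close>. They converge to the partial derivative and are dominated by a multiple of the
indicator of a ball, because \<open>f\<close> is Lipschitz.\<close>

lemma integral_partial_derivative_eq_0:
  fixes f :: "'a::euclidean_space \<Rightarrow> real"
  assumes f: "Ck 1 f" and K: "compact K" "\<And>x. x \<notin> K \<Longrightarrow> f x = 0" and b: "b \<in> Basis"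
  shows "(\<integral>x. grad f x \<bullet> b \<partial>lborel) = 0"
proof -
  define t where "t n = 1 / real (Suc n)" for n
  have t: "t n > 0" "t n \<le> 1" for n by (auto simp: t_def divide_simps)
  define g where "g n x = (f (x + t n *\<^sub>R b) - f x) / t n" for n x
  obtain r where r: "K \<subseteq> ball 0 r" "r > 0" using compact_imp_bounded[OF K(1)] bounded_subset_ballD by blast
  have cf: "continuous_on S f" for S using f C1_continuous[of 0] by simp
  have d0: "grad f x = 0" if "x \<notin> K" for x
    using grad_eq_0_off_support[OF compact_imp_closed[OF K(1)] K(2) that] .
  have "bounded (grad f ` K)"
    by (intro compact_imp_bounded compact_continuous_image C1_continuous_grad f K)
  then obtain M where M: "M > 0" "\<And>x. x \<in> K \<Longrightarrow> norm (grad f x) \<le> M"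
    by (auto simp: bounded_pos)
  then have Mb: "norm (grad f x) \<le> M" for x
    using d0[of x] by (cases "x \<in> K") auto
  have lip: "\<bar>f y - f x\<bar> \<le> M * norm (y - x)" for x y
  proof -
    have "onorm (\<lambda>y. grad f x \<bullet> y) \<le> M" for x
      using order_trans[OF Cauchy_Schwarz_ineq2 mult_right_mono[OF Mb norm_ge_zero]] M(1)
      by (intro onorm_bound) auto
    then show ?thesis
      using differentiable_bound[of UNIV f "\<lambda>x y. grad f x \<bullet> y" M y x] C1_has_derivative_grad[of 0 f] f
      by simp
  qed
  have gm: "g n \<in> borel_measurable borel" for n
    unfolding g_def by (intro borel_measurable_continuous_onI continuous_intros continuous_on_compose2[OF cf[of UNIV]]) (use t[of n] in auto)
  have "(\<lambda>n. \<integral>x. g n x \<partial>lborel) \<longlonglongrightarrow> (\<integral>x. grad f x \<bullet> b \<partial>lborel)"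
  proof (rule integral_dominated_convergence[where w = "\<lambda>x. M * indicator (ball 0 (r+1)) x"])
    show "(\<lambda>x. grad f x \<bullet> b) \<in> borel_measurable lborel"
      using C1_continuous_grad[OF f, of UNIV] by (auto intro!: borel_measurable_continuous_onI continuous_intros)
    show "g n \<in> borel_measurable lborel" for n using gm by simp
    show "integrable lborel (\<lambda>x. M * indicator (ball 0 (r+1)) x)"
      by (intro integrable_mult_right integrable_real_indicator) (use emeasure_lborel_ball_finite in auto)
    show "AE x in lborel. (\<lambda>n. g n x) \<longlonglongrightarrow> grad f x \<bullet> b"
    proof (rule AE_I2)
      fix x
      have "((\<lambda>s. x + s *\<^sub>R b) has_derivative (\<lambda>s. s *\<^sub>R b)) (at 0)"
        by (auto intro!: derivative_eq_intros)
      then have "((\<lambda>s. f (x + s *\<^sub>R b)) has_derivative (\<lambda>s. grad f x \<bullet> (s *\<^sub>R b))) (at 0)"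
        using has_derivative_compose[of "\<lambda>s. x + s *\<^sub>R b" "\<lambda>s. s *\<^sub>R b" 0 UNIV f "\<lambda>y. grad f x \<bullet> y"]
          C1_has_derivative_grad[of 0 f x] f by simp
      then have "((\<lambda>s. f (x + s *\<^sub>R b)) has_real_derivative grad f x \<bullet> b) (at 0)"
        by (simp add: has_field_derivative_def mult_commute_abs)
      then have "((\<lambda>s. (f (x + s *\<^sub>R b) - f x) / s) \<longlongrightarrow> grad f x \<bullet> b) (at 0)"
        by (simp add: DERIV_def)
      moreover have "filterlim t (at 0) sequentially"
        unfolding filterlim_at
      proof
        show "t \<longlonglongrightarrow> 0" unfolding t_def using LIMSEQ_inverse_real_of_nat by (simp add: inverse_eq_divide)
      qed (use t(1) in \<open>auto simp: less_imp_neq[symmetric]\<close>)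
      ultimately show "(\<lambda>n. g n x) \<longlonglongrightarrow> grad f x \<bullet> b"
        unfolding g_def by (rule filterlim_compose)
    qed
    show "AE x in lborel. norm (g n x) \<le> M * indicator (ball 0 (r+1)) x" for n
    proof (rule AE_I2)
      fix x
      show "norm (g n x) \<le> M * indicator (ball 0 (r+1)) x"
      proof (cases "x \<in> ball 0 (r+1)")
        case True
        then show ?thesis using lip[of "x + t n *\<^sub>R b" x] t[of n] b
          by (simp add: g_def divide_simps abs_mult mult.commute)
      next
        case False
        have "norm x \<le> norm (x + t n *\<^sub>R b) + norm (t n *\<^sub>R b)" using norm_triangle_ineq4[of "x + t n *\<^sub>R b" "t n *\<^sub>R b"] by simp
        then have "norm (x + t n *\<^sub>R b) \<ge> r" using False t[of n] b by simp
        then have "f x = 0" "f (x + t n *\<^sub>R b) = 0" using False r by (auto intro!: K(2))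
        then show ?thesis using False by (simp add: g_def)
      qed
    qed
  qed
  moreover have "(\<integral>x. g n x \<partial>lborel) = 0" for n
  proof -
    have i: "integrable lborel f"
      by (rule compact_support_integrable_lborel[OF cf K(1) subset_UNIV K(2) open_UNIV])
    have m: "f \<in> borel_measurable borel" using cf by (rule borel_measurable_continuous_onI)
    have i2: "integrable lborel (\<lambda>x. f (x + t n *\<^sub>R b))" and e: "(\<integral>x. f (x + t n *\<^sub>R b) \<partial>lborel) = (\<integral>x. f x \<partial>lborel)"
      using integrable_distr_eq[of "(+) (t n *\<^sub>R b)" lborel borel f] integral_distr[of "(+) (t n *\<^sub>R b)" lborel borel f] i m
      by (simp_all add: lborel_distr_plus add.commute)
    show ?thesis unfolding g_def using i i2 e by simp
  qed
  ultimately show ?thesis by (simp add: LIMSEQ_const_iff)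
qed

lemma integration_by_parts:
  fixes f :: "'a::euclidean_space \<Rightarrow> real"
  assumes f: "Ck 1 f" and \<psi>: "\<psi> \<in> test_functions \<Omega>" and \<Omega>: "open \<Omega>" and b: "b \<in> Basis"
  shows "(\<integral>x. f x * (grad \<psi> x \<bullet> b) \<partial>lebesgue_on \<Omega>) = - (\<integral>x. \<psi> x * (grad f x \<bullet> b) \<partial>lebesgue_on \<Omega>)"
proof -
  obtain K where K: "compact K" "K \<subseteq> \<Omega>" "\<And>x. x \<notin> K \<Longrightarrow> \<psi> x = 0" "\<And>x. x \<notin> K \<Longrightarrow> grad \<psi> x = 0"
    using test_functionsE[OF \<psi>] by blast
  have p: "Ck 1 \<psi>" using test_functions_smooth[OF \<psi>] by blast
  have c: "continuous_on UNIV (\<lambda>x. f x * (grad \<psi> x \<bullet> b))" "continuous_on UNIV (\<lambda>x. \<psi> x * (grad f x \<bullet> b))"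
    using C1_continuous_grad[OF f] C1_continuous_grad[OF p] C1_continuous[of 0] f p
    by (auto intro!: continuous_intros)
  note i1 = compact_support_integrable_lborel[OF c(1) K(1,2) _ \<Omega>] compact_support_integrable_lborel[OF c(2) K(1,2) _ \<Omega>]
  note i2 = compact_support_integral[OF c(1) K(1,2) _ \<Omega>] compact_support_integral[OF c(2) K(1,2) _ \<Omega>]
  have "(\<integral>x. grad (\<lambda>x. f x * \<psi> x) x \<bullet> b \<partial>lborel) = 0"
    by (rule integral_partial_derivative_eq_0[OF Ck_mult[OF f p] K(1) _ b]) (simp add: K)
  then have "(\<integral>x. f x * (grad \<psi> x \<bullet> b) + \<psi> x * (grad f x \<bullet> b) \<partial>lborel) = 0"
    by (simp add: grad_mult[OF f p] inner_add_left)
  then have "(\<integral>x. f x * (grad \<psi> x \<bullet> b) \<partial>lborel) + (\<integral>x. \<psi> x * (grad f x \<bullet> b) \<partial>lborel) = 0"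
    by (subst (asm) Bochner_Integration.integral_add) (use i1 K in auto)
  then show ?thesis using i2 K by simp
qed

text \<open>Integrate \<open>\<psi>\<close> by parts against a coordinate function, which is bounded by \<open>R\<close> on \<open>\<Omega>\<close>.\<close>

lemma L1_Poincare_test_function:
  fixes \<Omega> :: "'a::euclidean_space set"
  assumes \<psi>: "\<psi> \<in> test_functions \<Omega>" and \<Omega>: "open \<Omega>" "\<Omega> \<subseteq> ball 0 R" and pos: "\<And>x. 0 \<le> \<psi> x"
  shows "(\<integral>x. \<psi> x \<partial>lebesgue_on \<Omega>) \<le> R * (\<integral>x. norm (grad \<psi> x) \<partial>lebesgue_on \<Omega>)"
proof -
  obtain b :: 'a where b: "b \<in> Basis" using nonempty_Basis by blast
  obtain K where K: "compact K" "K \<subseteq> \<Omega>" "\<And>x. x \<notin> K \<Longrightarrow> \<psi> x = 0" "\<And>x. x \<notin> K \<Longrightarrow> grad \<psi> x = 0"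
    using test_functionsE[OF \<psi>] by blast
  have p: "Ck 1 \<psi>" using test_functions_smooth[OF \<psi>] by blast
  have g: "grad (\<lambda>x. x \<bullet> b) x = b" for x
    by (intro grad_eqI) (auto intro!: derivative_eq_intros simp: inner_commute)
  have c: "continuous_on UNIV (\<lambda>x. (x \<bullet> b) * (grad \<psi> x \<bullet> b))" "continuous_on UNIV (\<lambda>x. norm (grad \<psi> x))"
    using C1_continuous_grad[OF p] by (auto intro!: continuous_intros)
  have "(\<integral>x. \<psi> x \<partial>lebesgue_on \<Omega>) = - (\<integral>x. (x \<bullet> b) * (grad \<psi> x \<bullet> b) \<partial>lebesgue_on \<Omega>)"
    using integration_by_parts[OF Ck_inner \<psi> \<Omega>(1) b] b by (simp add: g)
  also have "\<dots> = (\<integral>x. - ((x \<bullet> b) * (grad \<psi> x \<bullet> b)) \<partial>lebesgue_on \<Omega>)" by simp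
  also have "\<dots> \<le> (\<integral>x. R * norm (grad \<psi> x) \<partial>lebesgue_on \<Omega>)"
  proof (rule integral_mono)
    show "integrable (lebesgue_on \<Omega>) (\<lambda>x. - ((x \<bullet> b) * (grad \<psi> x \<bullet> b)))"
      using compact_support_integrable[OF c(1) K(1,2) _ \<Omega>(1)] K by simp
    show "integrable (lebesgue_on \<Omega>) (\<lambda>x. R * norm (grad \<psi> x))"
      using compact_support_integrable[OF c(2) K(1,2) _ \<Omega>(1)] K by simp
    fix x assume "x \<in> space (lebesgue_on \<Omega>)"
    then have "norm x < R" using \<Omega> by (auto simp: space_restrict_space)
    moreover have "\<bar>x \<bullet> b\<bar> \<le> norm x" "\<bar>grad \<psi> x \<bullet> b\<bar> \<le> norm (grad \<psi> x)"
      using b by (auto simp: Basis_le_norm)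
    ultimately have "\<bar>(x \<bullet> b) * (grad \<psi> x \<bullet> b)\<bar> \<le> R * norm (grad \<psi> x)"
      unfolding abs_mult by (intro mult_mono) auto
    then show "- ((x \<bullet> b) * (grad \<psi> x \<bullet> b)) \<le> R * norm (grad \<psi> x)" by linarith
  qed
  finally show ?thesis by simp
qed

lemma continuous_absolutely_integrable_compact:
  fixes f :: "'a::euclidean_space \<Rightarrow> 'b::euclidean_space"
  assumes "continuous_on UNIV f" "compact K"
  shows "f absolutely_integrable_on K"
proof -
  have m: "(\<lambda>x. indicator K x *\<^sub>R f x) \<in> borel_measurable borel"
    using assms by (intro borel_measurable_scaleR borel_measurable_indicator borel_measurable_continuous_onI) (auto simp: compact_imp_closed)
  show ?thesis
    using borel_integrable_compact[OF assms(2) continuous_on_subset[OF assms(1)]] m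
    by (simp add: set_integrable_def integrable_completion)
qed

lemma C1_has_weak_gradient:
  assumes f: "Ck 1 f" and \<Omega>: "open \<Omega>"
  shows "has_weak_gradient \<Omega> f (grad f)"
  unfolding has_weak_gradient_def
proof (intro conjI allI impI ballI)
  have c: "continuous_on UNIV f" "continuous_on UNIV (grad f)"
    using C1_continuous[of 0] C1_continuous_grad f by auto
  show "f absolutely_integrable_on K" "grad f absolutely_integrable_on K" if "compact K \<and> K \<subseteq> \<Omega>" for K
    using that c continuous_absolutely_integrable_compact by blast+
  fix \<psi> assume \<psi>: "\<psi> \<in> test_functions \<Omega>"
  obtain K where K: "compact K" "K \<subseteq> \<Omega>" "\<And>x. x \<notin> K \<Longrightarrow> \<psi> x = 0" "\<And>x. x \<notin> K \<Longrightarrow> grad \<psi> x = 0"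
    using test_functionsE[OF \<psi>] by blast
  have p: "Ck 1 \<psi>" using test_functions_smooth[OF \<psi>] by blast
  have c': "continuous_on UNIV (\<lambda>x. f x *\<^sub>R grad \<psi> x)" "continuous_on UNIV (\<lambda>x. \<psi> x *\<^sub>R grad f x)"
    using c C1_continuous[of 0] C1_continuous_grad p by (auto intro!: continuous_intros)
  have i: "integrable (lebesgue_on \<Omega>) (\<lambda>x. f x *\<^sub>R grad \<psi> x)" "integrable (lebesgue_on \<Omega>) (\<lambda>x. \<psi> x *\<^sub>R grad f x)"
    using compact_support_integrable[OF c'(1) K(1,2) _ \<Omega>] compact_support_integrable[OF c'(2) K(1,2) _ \<Omega>] K by auto
  show "(\<integral>x. f x *\<^sub>R grad \<psi> x \<partial>lebesgue_on \<Omega>) = - (\<integral>x. \<psi> x *\<^sub>R grad f x \<partial>lebesgue_on \<Omega>)"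
  proof (rule euclidean_eqI)
    fix b :: 'a assume "b \<in> Basis"
    then show "(\<integral>x. f x *\<^sub>R grad \<psi> x \<partial>lebesgue_on \<Omega>) \<bullet> b = - (\<integral>x. \<psi> x *\<^sub>R grad f x \<partial>lebesgue_on \<Omega>) \<bullet> b"
      using integration_by_parts[OF f \<psi> \<Omega>] integral_inner_left[OF i(1), of b] integral_inner_left[OF i(2), of b]
      by simp
  qed
qed

section \<open>Uniqueness of weak gradients\<close>

definition box_bump :: "nat \<Rightarrow> 'a::euclidean_space \<Rightarrow> 'a \<Rightarrow> 'a \<Rightarrow> real" where
  "box_bump n a b x = (\<Prod>i\<in>Basis. flat 0 (real n * (x \<bullet> i - a \<bullet> i)) * flat 0 (real n * (b \<bullet> i - x \<bullet> i)))"

lemma smooth_box_bump: "smooth (box_bump n a b)"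
  unfolding box_bump_def by (auto intro!: Ck_prod Ck_mult Ck_flat Ck_diff Ck_inner)

lemma box_bump_nonneg: "0 \<le> box_bump n a b x"
  by (auto simp: box_bump_def flat_nonneg intro!: prod_nonneg)

lemma box_bump_le_1: "box_bump n a b x \<le> 1"
  by (auto simp: box_bump_def flat_nonneg flat_0_le_1 intro!: prod_le_1 mult_le_one)

lemma box_bump_eq_0: "x \<notin> box a b \<Longrightarrow> box_bump n a b x = 0"
  by (fastforce simp: box_bump_def mem_box prod_zero_iff flat_eq_0_iff not_less intro: mult_nonneg_nonpos)

lemma box_bump_tendsto: "(\<lambda>n. box_bump n a b x) \<longlonglongrightarrow> indicator (box a b) x"
proof -
  have "(\<lambda>n. box_bump n a b x) \<longlonglongrightarrow>
     (\<Prod>i\<in>Basis. indicator {0<..} (x \<bullet> i - a \<bullet> i) * indicator {0<..} (b \<bullet> i - x \<bullet> i))"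
    unfolding box_bump_def by (intro tendsto_prod tendsto_mult flat_0_rescaled_tendsto)
  also have "(\<Prod>i\<in>Basis. indicator {0<..} (x \<bullet> i - a \<bullet> i) * indicator {0<..} (b \<bullet> i - x \<bullet> i)) = (indicator (box a b) x :: real)"
  proof (cases "x \<in> box a b")
    case True
    then show ?thesis by (auto simp: mem_box)
  next
    case False
    then obtain i where "i \<in> Basis" "\<not> (a \<bullet> i < x \<bullet> i \<and> x \<bullet> i < b \<bullet> i)" by (auto simp: mem_box)
    then show ?thesis using False by (auto simp: prod_zero_iff intro!: bexI[of _ i])
  qed
  finally show ?thesis .
qed

lemma sigma_finite_lebesgue: "sigma_finite_measure (lebesgue :: 'a::euclidean_space measure)"
proof
  obtain A :: "'a set set" where "countable A" "A \<subseteq> sets lborel" "\<Union>A = space lborel" "\<forall>a\<in>A. emeasure lborel a \<noteq> \<infinity>"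
    using lborel.sigma_finite_countable by blast
  then show "\<exists>A::'a set set. countable A \<and> A \<subseteq> sets lebesgue \<and> \<Union>A = space lebesgue \<and> (\<forall>a\<in>A. emeasure lebesgue a \<noteq> \<infinity>)"
    by (intro exI[of _ A]) auto
qed

text \<open>Products of bumps are test functions, so on a box compactly contained in \<open>\<Omega>\<close> the integral
of \<open>G\<close> over every smaller box vanishes. Boxes form an intersection-stable generator of the
Borel sets, hence all integrals of \<open>G\<close> over Borel subsets of the box vanish, and \<open>G\<close> is
zero almost everywhere there. Countably many boxes cover \<open>\<Omega>\<close>.\<close>

lemma AE_eq_0_if_orthogonal_to_test_functions:
  fixes G :: "'a::euclidean_space \<Rightarrow> 'b::euclidean_space"
  assumes \<Omega>: "open \<Omega>"
    and G: "\<And>K. compact K \<Longrightarrow> K \<subseteq> \<Omega> \<Longrightarrow> G absolutely_integrable_on K"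
    and orth: "\<And>\<psi>. \<psi> \<in> test_functions \<Omega> \<Longrightarrow> (\<integral>x. \<psi> x *\<^sub>R G x \<partial>lebesgue_on \<Omega>) = 0"
  shows "AE x in lebesgue_on \<Omega>. G x = 0"
proof -
  have \<Omega>s: "\<Omega> \<in> sets lebesgue" using \<Omega> by auto
  have box0: "AE x in lebesgue. x \<in> box a b \<longrightarrow> G x = 0" if ab: "cbox a b \<subseteq> \<Omega>" for a b
  proof -
    define g where "g x = indicator (box a b) x *\<^sub>R G x" for x
    have "integrable lebesgue (\<lambda>x. indicator (cbox a b) x *\<^sub>R G x)"
      using G[OF compact_cbox ab] by (simp add: set_integrable_def)
    from integrable_mult_indicator[OF _ this, of "box a b"]
    have "integrable lebesgue (\<lambda>x. indicator (box a b) x *\<^sub>R indicator (cbox a b) x *\<^sub>R G x)" by simp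
    also have "(\<lambda>x. indicator (box a b) x *\<^sub>R indicator (cbox a b) x *\<^sub>R G x) = g"
      using box_subset_cbox by (fastforce simp: g_def fun_eq_iff split: split_indicator)
    finally have gi: "integrable lebesgue g" .
    have ii: "integrable lebesgue (\<lambda>x. indicator A x *\<^sub>R g x)" if "A \<in> sets lebesgue" for A
      using integrable_mult_indicator[OF that gi] .
    \<comment> \<open>The bump on \<open>box a b\<close> keeps the support inside \<open>\<Omega>\<close> for arbitrary \<open>c\<close> and \<open>d\<close>.\<close>
    have gboxes: "(\<integral>x. indicator (box c d) x *\<^sub>R g x \<partial>lebesgue) = 0" for c d
    proof -
      let ?\<psi> = "\<lambda>n x. box_bump n a b x * box_bump n c d x"
      have z: "(\<integral>x. ?\<psi> n x *\<^sub>R g x \<partial>lebesgue) = 0" for n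
      proof -
        have "?\<psi> n \<in> test_functions \<Omega>"
        proof (rule test_functionsI[OF _ compact_cbox ab])
          show "smooth (?\<psi> n)" using smooth_box_bump by (blast intro: Ck_mult)
          show "?\<psi> n x = 0" if "x \<notin> cbox a b" for x
            using that box_bump_eq_0[of x a b n] box_subset_cbox[of a b] by auto
        qed
        from orth[OF this] have "(\<integral>x. indicator \<Omega> x *\<^sub>R ?\<psi> n x *\<^sub>R G x \<partial>lebesgue) = 0"
          using \<Omega>s by (simp add: integral_restrict_space)
        also have "(\<lambda>x. indicator \<Omega> x *\<^sub>R ?\<psi> n x *\<^sub>R G x) = (\<lambda>x. ?\<psi> n x *\<^sub>R g x)"
          using ab box_subset_cbox[of a b] box_bump_eq_0[of _ a b n]
          by (fastforce simp: g_def fun_eq_iff split: split_indicator)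
        finally show ?thesis .
      qed
      have m: "(\<lambda>x. ?\<psi> n x) \<in> borel_measurable lebesgue" for n
        using smooth_continuous[OF smooth_box_bump]
        by (intro measurable_completion) (auto intro!: borel_measurable_continuous_onI continuous_on_mult)
      have "(\<lambda>n. \<integral>x. ?\<psi> n x *\<^sub>R g x \<partial>lebesgue) \<longlonglongrightarrow> (\<integral>x. (indicator (box a b) x * indicator (box c d) x) *\<^sub>R g x \<partial>lebesgue)"
      proof (rule integral_dominated_convergence[where w = "\<lambda>x. norm (g x)"])
        show "(\<lambda>x. (indicator (box a b) x * indicator (box c d) x) *\<^sub>R g x) \<in> borel_measurable lebesgue"
          using gi by (intro borel_measurable_scaleR borel_measurable_times borel_measurable_indicator) auto
        show "(\<lambda>x. ?\<psi> n x *\<^sub>R g x) \<in> borel_measurable lebesgue" for n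
          using gi m by (intro borel_measurable_scaleR) auto
        show "integrable lebesgue (\<lambda>x. norm (g x))" using gi by simp
        show "AE x in lebesgue. (\<lambda>n. ?\<psi> n x *\<^sub>R g x) \<longlonglongrightarrow> (indicator (box a b) x * indicator (box c d) x) *\<^sub>R g x"
          by (intro AE_I2 tendsto_intros box_bump_tendsto)
        have "norm (?\<psi> n x) \<le> 1" for n x
          by (simp add: abs_mult box_bump_nonneg box_bump_le_1 mult_le_one)
        from mult_right_mono[OF this norm_ge_zero]
        show "AE x in lebesgue. norm (?\<psi> n x *\<^sub>R g x) \<le> norm (g x)" for n
          by (auto intro!: AE_I2)
      qed
      then have "(\<integral>x. (indicator (box a b) x * indicator (box c d) x) *\<^sub>R g x \<partial>lebesgue) = 0"
        unfolding z by (simp add: LIMSEQ_const_iff)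
      also have "(\<lambda>x. (indicator (box a b) x * indicator (box c d) x) *\<^sub>R g x) = (\<lambda>x. indicator (box c d) x *\<^sub>R g x)"
        by (auto simp: g_def fun_eq_iff split: split_indicator)
      finally show ?thesis .
    qed
    have whole: "(\<integral>x. g x \<partial>lebesgue) = 0"
    proof -
      have "(\<lambda>x. indicator (box a b) x *\<^sub>R g x) = g"
        by (auto simp: g_def fun_eq_iff split: split_indicator)
      then show ?thesis using gboxes[of a b] by simp
    qed
    have borel0: "(\<integral>x. indicator A x *\<^sub>R g x \<partial>lebesgue) = 0" if A: "A \<in> sets borel" for A
    proof -
      have "Int_stable (range (\<lambda>(a, b). box a b :: 'a set))"
        by (auto simp: Int_stable_def box_Int_box)
      moreover have "range (\<lambda>(a, b). box a b :: 'a set) \<subseteq> Pow UNIV" by auto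
      moreover have "A \<in> sigma_sets UNIV (range (\<lambda>(a, b). box a b))"
        using A unfolding borel_eq_box by simp
      ultimately show ?thesis
      proof (induction rule: sigma_sets_induct_disjoint)
        case (basic A)
        then show ?case using gboxes by auto
      next
        case empty
        then show ?case by simp
      next
        case (compl A)
        then have "A \<in> sets borel" by (simp add: borel_eq_box)
        then have "A \<in> sets lebesgue" by simp
        have "(\<integral>x. indicator (UNIV - A) x *\<^sub>R g x \<partial>lebesgue) = (\<integral>x. g x - indicator A x *\<^sub>R g x \<partial>lebesgue)"
          by (intro Bochner_Integration.integral_cong) (auto split: split_indicator)
        then show ?case
          using compl.IH whole gi ii[OF \<open>A \<in> sets lebesgue\<close>] by simp
      next
        case (union F)
        then have F: "F i \<in> sets lebesgue" for i
          using union.hyps by (metis borel_eq_box sets_completionI_sets sets_lborel sets_measure_of range_subsetD subset_UNIV Pow_UNIV)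
        have "set_integrable lebesgue (\<Union>i. F i) g"
          unfolding set_integrable_def using ii F by blast
        from lebesgue_integral_countable_add[OF F _ this]
        have "(LINT x:(\<Union>i. F i)|lebesgue. g x) = (\<Sum>i. LINT x:F i|lebesgue. g x)"
          using union.hyps by (auto simp: disjoint_family_on_def)
        then show ?case using union.IH by (simp add: set_lebesgue_integral_def)
      qed
    qed
    have "AE x in lebesgue. g x = 0"
    proof (rule sigma_finite_measure.density_zero[OF sigma_finite_lebesgue gi])
      fix A :: "'a set" assume A: "A \<in> sets lebesgue"
      obtain N where N: "N \<in> null_sets lborel" "null_part lborel A \<subseteq> N"
        using null_part[OF A] by blast
      then have N': "N \<in> null_sets lebesgue" using null_sets_completionI by blast
      have "AE x in lebesgue. indicator A x *\<^sub>R g x = indicator (main_part lborel A) x *\<^sub>R g x"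
        using AE_not_in[OF N'] 
      proof eventually_elim
        case (elim x)
        then have "x \<in> A \<longleftrightarrow> x \<in> main_part lborel A"
          using main_part_null_part_Un[OF A] N(2) by blast
        then show ?case by (simp add: indicator_def)
      qed
      moreover have mb: "main_part lborel A \<in> sets borel" using main_part_sets[OF A] by simp
      ultimately have "(\<integral>x. indicator A x *\<^sub>R g x \<partial>lebesgue) = (\<integral>x. indicator (main_part lborel A) x *\<^sub>R g x \<partial>lebesgue)"
        using ii[OF A] ii[of "main_part lborel A"] by (intro integral_cong_AE) auto
      then show "set_lebesgue_integral lebesgue A g = 0"
        unfolding set_lebesgue_integral_def using borel0[OF mb] by simp
    qed
    then show ?thesis
      by eventually_elim (auto simp: g_def)
  qed
  \<comment> \<open>The countable cover consists of closed boxes, whose boundaries are null sets.\<close>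
  have cbox0: "AE x in lebesgue. x \<in> cbox a b \<longrightarrow> G x = 0" if "cbox a b \<subseteq> \<Omega>" for a b
  proof -
    have "cbox a b - box a b \<in> null_sets lebesgue"
      using negligible_frontier_interval by (simp add: negligible_iff_null_sets)
    then show ?thesis using box0[OF that] AE_not_in by fastforce
  qed
  obtain D where D: "countable D" "D \<subseteq> Pow \<Omega>" "\<And>X. X \<in> D \<Longrightarrow> \<exists>a b. X = cbox a b" "\<Union>D = \<Omega>"
    using open_countable_Union_open_cbox[OF \<Omega>] by metis
  have "AE x in lebesgue. \<forall>X\<in>D. x \<in> X \<longrightarrow> G x = 0"
    unfolding AE_ball_countable[OF D(1)]
  proof
    fix X assume "X \<in> D"
    with D obtain a b where "X = cbox a b" "cbox a b \<subseteq> \<Omega>" by blast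
    then show "AE x in lebesgue. x \<in> X \<longrightarrow> G x = 0" using cbox0 by simp
  qed
  then have "AE x in lebesgue. x \<in> \<Omega> \<longrightarrow> G x = 0"
    by eventually_elim (use D(4) in auto)
  then show ?thesis using \<Omega>s by (simp add: AE_restrict_space_iff)
qed

lemma borel_measurable_lebesgue_on_AE:
  fixes f :: "'a::euclidean_space \<Rightarrow> 'b::euclidean_space"
  assumes S: "S \<in> sets lebesgue" and f: "f \<in> borel_measurable (lebesgue_on S)" and ae: "AE x in lebesgue_on S. f x = g x"
  shows "g \<in> borel_measurable (lebesgue_on S)"
proof -
  have "(\<lambda>x. indicator S x *\<^sub>R f x) \<in> borel_measurable lebesgue"
    using f S by (simp add: borel_measurable_restrict_space_iff)
  moreover have "AE x in lebesgue. indicator S x *\<^sub>R f x = indicator S x *\<^sub>R g x"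
    using ae S by (subst (asm) AE_restrict_space_iff) (auto elim!: eventually_mono simp: indicator_def)
  ultimately have "(\<lambda>x. indicator S x *\<^sub>R g x) \<in> borel_measurable lebesgue"
    by (rule borel_measurable_AE)
  then show ?thesis using S by (simp add: borel_measurable_restrict_space_iff)
qed

lemma integrable_lebesgue_on_if_compact_support:
  fixes F :: "'a::euclidean_space \<Rightarrow> 'b::euclidean_space"
  assumes "open \<Omega>" "K \<subseteq> \<Omega>" "F absolutely_integrable_on K" "\<And>x. x \<notin> K \<Longrightarrow> F x = 0"
  shows "integrable (lebesgue_on \<Omega>) F"
proof -
  have "(\<lambda>x. indicator \<Omega> x *\<^sub>R F x) = (\<lambda>x. indicator K x *\<^sub>R F x)"
    using assms(2,4) by (fastforce simp: fun_eq_iff split: split_indicator)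
  moreover have "\<Omega> \<in> sets lebesgue" using assms(1) by auto
  ultimately show ?thesis
    using assms(3) by (simp add: integrable_restrict_space set_integrable_def)
qed

lemma absolutely_integrable_continuous_scaleR:
  fixes G :: "'a::euclidean_space \<Rightarrow> 'b::euclidean_space"
  assumes K: "compact K" and h: "continuous_on UNIV h" and G: "G absolutely_integrable_on K"
  shows "(\<lambda>x. h x *\<^sub>R G x) absolutely_integrable_on K"
proof (rule absolutely_integrable_bounded_measurable_product[where h = "\<lambda>r v. r *\<^sub>R v", OF _ _ _ _ G])
  show "bilinear (\<lambda>(r::real) v::'b. r *\<^sub>R v)"
    by (simp add: bilinear_conv_bounded_bilinear bounded_bilinear_scaleR)
  show "K \<in> sets lebesgue" using K by (simp add: compact_imp_closed lebesgue_closedin)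
  show "h \<in> borel_measurable (lebesgue_on K)"
    using h by (intro measurable_restrict_space1 measurable_completion) (simp add: borel_measurable_continuous_onI)
  show "bounded (h ` K)"
    by (intro compact_imp_bounded compact_continuous_image K continuous_on_subset[OF h]) simp
qed

lemma absolutely_integrable_scaleR_continuous:
  fixes H :: "'a::euclidean_space \<Rightarrow> 'b::euclidean_space"
  assumes K: "compact K" and h: "continuous_on UNIV H" and G: "u absolutely_integrable_on K"
  shows "(\<lambda>x. u x *\<^sub>R H x) absolutely_integrable_on K"
proof (rule absolutely_integrable_bounded_measurable_product[where h = "\<lambda>v r. r *\<^sub>R v", OF _ _ _ _ G])
  have "bilinear (\<lambda>(r::real) v::'b. r *\<^sub>R v)"
    by (simp add: bilinear_conv_bounded_bilinear bounded_bilinear_scaleR)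
  then show "bilinear (\<lambda>(v::'b) (r::real). r *\<^sub>R v)" by (simp add: bilinear_def)
  show "K \<in> sets lebesgue" using K by (simp add: compact_imp_closed lebesgue_closedin)
  show "H \<in> borel_measurable (lebesgue_on K)"
    using h by (intro measurable_restrict_space1 measurable_completion) (simp add: borel_measurable_continuous_onI)
  show "bounded (H ` K)"
    by (intro compact_imp_bounded compact_continuous_image K continuous_on_subset[OF h]) simp
qed

text \<open>The integrals in the definition of a weak gradient have to be finite before they can be
subtracted; this is where local integrability and the compact support of test functions
are used.\<close>

lemma has_weak_gradient_diff:
  assumes \<Omega>: "open \<Omega>" and u: "has_weak_gradient \<Omega> u G" and v: "has_weak_gradient \<Omega> v H"
  shows "has_weak_gradient \<Omega> (\<lambda>x. u x - v x) (\<lambda>x. G x - H x)"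
  unfolding has_weak_gradient_def
proof (intro conjI allI impI ballI)
  show "(\<lambda>x. u x - v x) absolutely_integrable_on K" "(\<lambda>x. G x - H x) absolutely_integrable_on K"
    if "compact K \<and> K \<subseteq> \<Omega>" for K
    using that u v by (auto simp: has_weak_gradient_def intro!: set_integral_diff(1))
  fix \<psi> assume \<psi>: "\<psi> \<in> test_functions \<Omega>"
  obtain K where K: "compact K" "K \<subseteq> \<Omega>" "\<And>x. x \<notin> K \<Longrightarrow> \<psi> x = 0" "\<And>x. x \<notin> K \<Longrightarrow> grad \<psi> x = 0"
    using test_functionsE[OF \<psi>] by blast
  have c: "continuous_on UNIV \<psi>" "continuous_on UNIV (grad \<psi>)"
    using test_functions_smooth[OF \<psi>] smooth_continuous[of \<psi>] C1_continuous_grad[of \<psi>] by blast+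
  have i: "integrable (lebesgue_on \<Omega>) (\<lambda>x. w x *\<^sub>R grad \<psi> x) \<and> integrable (lebesgue_on \<Omega>) (\<lambda>x. \<psi> x *\<^sub>R W x)"
    if "has_weak_gradient \<Omega> w W" for w W
  proof -
    have "w absolutely_integrable_on K" "W absolutely_integrable_on K"
      using that K by (auto simp: has_weak_gradient_def)
    then show ?thesis
      using K c by (intro conjI integrable_lebesgue_on_if_compact_support[OF \<Omega> K(2)]
        absolutely_integrable_continuous_scaleR absolutely_integrable_scaleR_continuous) auto
  qed
  have e: "(\<integral>x. w x *\<^sub>R grad \<psi> x \<partial>lebesgue_on \<Omega>) = - (\<integral>x. \<psi> x *\<^sub>R W x \<partial>lebesgue_on \<Omega>)"
    if "has_weak_gradient \<Omega> w W" for w W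
    using that \<psi> by (auto simp: has_weak_gradient_def)
  show "(\<integral>x. (u x - v x) *\<^sub>R grad \<psi> x \<partial>lebesgue_on \<Omega>) = - (\<integral>x. \<psi> x *\<^sub>R (G x - H x) \<partial>lebesgue_on \<Omega>)"
    using i[OF u] i[OF v] e[OF u] e[OF v] by (simp add: scaleR_diff_left scaleR_diff_right)
qed

lemma weak_gradient_unique:
  assumes \<Omega>: "open \<Omega>" and G: "has_weak_gradient \<Omega> u G" and H: "has_weak_gradient \<Omega> u H"
  shows "AE x in lebesgue_on \<Omega>. G x = H x"
proof -
  have d: "has_weak_gradient \<Omega> (\<lambda>x. 0) (\<lambda>x. G x - H x)"
    using has_weak_gradient_diff[OF \<Omega> G H] by simp
  have "AE x in lebesgue_on \<Omega>. G x - H x = 0"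
    by (rule AE_eq_0_if_orthogonal_to_test_functions[OF \<Omega>]) (use d in \<open>auto simp: has_weak_gradient_def\<close>)
  then show ?thesis by eventually_elim simp
qed

lemma has_weak_gradient_weak_grad: "has_weak_gradient \<Omega> u G \<Longrightarrow> has_weak_gradient \<Omega> u (weak_grad \<Omega> u)"
  unfolding weak_grad_def by (rule someI[of "has_weak_gradient \<Omega> u"])

section \<open>Dominated approximation of Sobolev functions by test functions\<close>

lemma Lp_AE_cong:
  fixes G :: "'a::euclidean_space \<Rightarrow> 'b::euclidean_space"
  assumes "\<Omega> \<in> sets lebesgue" "G \<in> Lp p \<Omega>" "AE x in lebesgue_on \<Omega>. G x = H x"
  shows "H \<in> Lp p \<Omega>"
proof -
  have m: "G \<in> borel_measurable (lebesgue_on \<Omega>)" "integrable (lebesgue_on \<Omega>) (\<lambda>x. norm (G x) powr p)"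
    using assms(2) by (auto simp: Lp_def)
  have H: "H \<in> borel_measurable (lebesgue_on \<Omega>)"
    using borel_measurable_lebesgue_on_AE[OF assms(1) m(1) assms(3)] .
  have "integrable (lebesgue_on \<Omega>) (\<lambda>x. norm (H x) powr p)"
    by (rule integrable_cong_AE_imp[OF m(2)]) (use H assms(3) in \<open>auto elim!: eventually_mono\<close>)
  with H show ?thesis by (simp add: Lp_def)
qed

lemma W1p_weak_grad:
  assumes "open \<Omega>" "u \<in> W1p p \<Omega>"
  shows "weak_grad \<Omega> u \<in> Lp p \<Omega>" "has_weak_gradient \<Omega> u (weak_grad \<Omega> u)"
proof -
  obtain G where G: "G \<in> Lp p \<Omega>" "has_weak_gradient \<Omega> u G" using assms(2) by (auto simp: W1p_def)
  show w: "has_weak_gradient \<Omega> u (weak_grad \<Omega> u)" by (rule has_weak_gradient_weak_grad[OF G(2)])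
  have "\<Omega> \<in> sets lebesgue" using assms(1) by auto
  then show "weak_grad \<Omega> u \<in> Lp p \<Omega>"
    by (rule Lp_AE_cong[OF _ G(1) weak_gradient_unique[OF assms(1) G(2) w]])
qed

text \<open>This is what turns convergence in \<open>W1p_norm\<close>, which speaks of the chosen weak gradient of
the difference, into convergence of the classical gradients.\<close>

lemma weak_grad_diff_smooth:
  assumes "open \<Omega>" "has_weak_gradient \<Omega> u G" "Ck 1 \<phi>"
  shows "AE x in lebesgue_on \<Omega>. weak_grad \<Omega> (\<lambda>x. u x - \<phi> x) x = weak_grad \<Omega> u x - grad \<phi> x"
proof -
  have "has_weak_gradient \<Omega> (\<lambda>x. u x - \<phi> x) (\<lambda>x. weak_grad \<Omega> u x - grad \<phi> x)"
    by (rule has_weak_gradient_diff[OF assms(1) has_weak_gradient_weak_grad[OF assms(2)] C1_has_weak_gradient[OF assms(3,1)]])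
  from weak_gradient_unique[OF assms(1) has_weak_gradient_weak_grad[OF this] this] show ?thesis .
qed

lemma powr_add_le:
  fixes a b p :: real
  assumes "0 \<le> a" "0 \<le> b" "0 < p"
  shows "(a + b) powr p \<le> 2 powr p * (a powr p + b powr p)"
proof -
  have "(a + b) powr p \<le> (2 * max a b) powr p" using assms by (intro powr_mono2) auto
  also have "\<dots> = 2 powr p * (max a b) powr p" using assms by (simp add: powr_mult)
  also have "\<dots> \<le> 2 powr p * (a powr p + b powr p)" by (intro mult_left_mono) (auto simp: max_def)
  finally show ?thesis .
qed

lemma integrable_powr_add:
  fixes f g :: "'a \<Rightarrow> real"
  assumes p: "0 < p" and f: "f \<in> borel_measurable M" "integrable M (\<lambda>x. f x powr p)" "AE x in M. 0 \<le> f x"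
    and g: "g \<in> borel_measurable M" "integrable M (\<lambda>x. g x powr p)" "AE x in M. 0 \<le> g x"
  shows "integrable M (\<lambda>x. (f x + g x) powr p)"
proof (rule Bochner_Integration.integrable_bound[where f = "\<lambda>x. 2 powr p * (f x powr p + g x powr p)"])
  show "integrable M (\<lambda>x. 2 powr p * (f x powr p + g x powr p))" using f g by simp
  show "(\<lambda>x. (f x + g x) powr p) \<in> borel_measurable M" using f g by measurable
  show "AE x in M. norm ((f x + g x) powr p) \<le> norm (2 powr p * (f x powr p + g x powr p))"
    using f(3) g(3) by eventually_elim (simp add: powr_add_le p)
qed

lemma Lp_diff:
  fixes f g :: "'a::euclidean_space \<Rightarrow> 'b::euclidean_space"
  assumes "f \<in> Lp p \<Omega>" "g \<in> Lp p \<Omega>" "0 < p"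
  shows "(\<lambda>x. f x - g x) \<in> Lp p \<Omega>"
proof -
  have m[measurable]: "f \<in> borel_measurable (lebesgue_on \<Omega>)" "g \<in> borel_measurable (lebesgue_on \<Omega>)"
    using assms by (auto simp: Lp_def)
  have "integrable (lebesgue_on \<Omega>) (\<lambda>x. norm (f x - g x) powr p)"
  proof (rule Bochner_Integration.integrable_bound[where f = "\<lambda>x. (norm (f x) + norm (g x)) powr p"])
    show "integrable (lebesgue_on \<Omega>) (\<lambda>x. (norm (f x) + norm (g x)) powr p)"
      using assms by (intro integrable_powr_add) (auto simp: Lp_def)
    show "(\<lambda>x. norm (f x - g x) powr p) \<in> borel_measurable (lebesgue_on \<Omega>)" by measurable
    show "AE x in lebesgue_on \<Omega>. norm (norm (f x - g x) powr p) \<le> norm ((norm (f x) + norm (g x)) powr p)"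
      using assms(3) by (intro AE_I2) (auto intro!: powr_mono2 norm_triangle_ineq4)
  qed
  then show ?thesis by (simp add: Lp_def)
qed

lemma test_function_Lp:
  assumes "\<phi> \<in> test_functions \<Omega>" "open \<Omega>" "0 < p"
  shows "\<phi> \<in> Lp p \<Omega>" "grad \<phi> \<in> Lp p \<Omega>"
proof -
  obtain K where K: "compact K" "K \<subseteq> \<Omega>" "\<And>x. x \<notin> K \<Longrightarrow> \<phi> x = 0" "\<And>x. x \<notin> K \<Longrightarrow> grad \<phi> x = 0"
    using test_functionsE[OF assms(1)] by blast
  have c: "continuous_on UNIV \<phi>" "continuous_on UNIV (grad \<phi>)"
    using test_functions_smooth[OF assms(1)] smooth_continuous[of \<phi>] C1_continuous_grad[of \<phi>] by blast+
  have l: "g \<in> Lp p \<Omega>" if "continuous_on UNIV g" "\<And>x. x \<notin> K \<Longrightarrow> g x = 0" for g :: "'a \<Rightarrow> 'b::euclidean_space"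
  proof -
    have "continuous_on UNIV (\<lambda>x. norm (g x) powr p)"
      using that assms(3) by (intro continuous_on_powr' continuous_intros) auto
    then show ?thesis
      using that compact_support_integrable[OF _ K(1,2) _ assms(2), of "\<lambda>x. norm (g x) powr p"]
        compact_support_integrable[OF _ K(1,2) _ assms(2), of g]
      by (simp add: Lp_def borel_measurable_integrable)
  qed
  show "\<phi> \<in> Lp p \<Omega>" "grad \<phi> \<in> Lp p \<Omega>" using l c K by blast+
qed

text \<open>Choose terms whose integrals decay geometrically. Their sum is integrable by monotone
convergence and dominates each of them, and summability forces pointwise convergence to
\<open>0\<close>.\<close>

lemma L1_null_dominated_subsequence:
  fixes f :: "nat \<Rightarrow> 'a \<Rightarrow> real"
  assumes f: "\<And>n. integrable M (f n)" "\<And>n x. 0 \<le> f n x" and lim: "(\<lambda>n. \<integral>x. f n x \<partial>M) \<longlonglongrightarrow> 0"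
  obtains r S where "integrable M S" "AE x in M. (\<lambda>k. f (r k) x) \<longlonglongrightarrow> 0" "AE x in M. \<forall>k. f (r k) x \<le> S x"
proof -
  have "\<exists>n. (\<integral>x. f n x \<partial>M) < (1/2) ^ k" for k
  proof -
    have "eventually (\<lambda>n. (\<integral>x. f n x \<partial>M) < (1/2) ^ k) sequentially"
      using lim by (rule order_tendstoD) simp
    then show ?thesis by (rule eventually_happens'[OF sequentially_bot])
  qed
  then obtain r where r: "(\<integral>x. f (r k) x \<partial>M) < (1/2) ^ k" for k by metis
  have sm: "summable (\<lambda>k. \<integral>x. f (r k) x \<partial>M)"
    by (rule summable_comparison_test[OF _ summable_geometric[of "1/2"]])
      (use r f in \<open>auto intro!: exI[of _ 0] less_imp_le simp: integral_nonneg_AE\<close>)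
  have "(\<integral>\<^sup>+x. (\<Sum>k. ennreal (f (r k) x)) \<partial>M) = (\<Sum>k. \<integral>\<^sup>+x. ennreal (f (r k) x) \<partial>M)"
    using f(1) by (intro nn_integral_suminf) auto
  also have "\<dots> = (\<Sum>k. ennreal (\<integral>x. f (r k) x \<partial>M))"
    using f by (simp add: nn_integral_eq_integral)
  also have "\<dots> = ennreal (\<Sum>k. \<integral>x. f (r k) x \<partial>M)"
    using sm f by (intro suminf_ennreal2) (auto intro: integral_nonneg_AE)
  finally have "(\<integral>\<^sup>+x. (\<Sum>k. ennreal (f (r k) x)) \<partial>M) \<noteq> \<infinity>" by simp
  then have "AE x in M. (\<Sum>k. ennreal (f (r k) x)) \<noteq> \<infinity>"
    using f(1) by (intro nn_integral_PInf_AE) auto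
  then have s: "AE x in M. summable (\<lambda>k. f (r k) x)"
    by eventually_elim (use f in \<open>auto intro!: summable_suminf_not_top\<close>)
  show ?thesis
  proof
    show "integrable M (\<lambda>x. \<Sum>k. f (r k) x)"
      by (rule integrable_suminf) (use f s sm in auto)
    show "AE x in M. (\<lambda>k. f (r k) x) \<longlonglongrightarrow> 0" using s by eventually_elim (rule summable_LIMSEQ_zero)
    show "AE x in M. \<forall>k. f (r k) x \<le> (\<Sum>k. f (r k) x)"
      using s by eventually_elim (auto intro!: sum_le_suminf[of _ "{_}", simplified] f)
  qed
qed

text \<open>Pointwise convergence with gradients under a common majorant in \<open>L\<^sup>p\<close>. Both limits of test
functions and globally smooth barriers satisfy it, so one comparison principle serves
both. The approximants carry no condition on the boundary; that is added where it is
needed.\<close>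

definition dominated_approx ::
  "real \<Rightarrow> 'a::euclidean_space set \<Rightarrow> (nat \<Rightarrow> 'a \<Rightarrow> real) \<Rightarrow> ('a \<Rightarrow> real) \<Rightarrow> ('a \<Rightarrow> 'a) \<Rightarrow> bool" where
  "dominated_approx p \<Omega> \<phi> u G \<longleftrightarrow> (\<forall>k. smooth (\<phi> k)) \<and>
     u \<in> borel_measurable (lebesgue_on \<Omega>) \<and> G \<in> borel_measurable (lebesgue_on \<Omega>) \<and>
     (AE x in lebesgue_on \<Omega>. (\<lambda>k. \<phi> k x) \<longlonglongrightarrow> u x) \<and>
     (AE x in lebesgue_on \<Omega>. (\<lambda>k. grad (\<phi> k) x) \<longlonglongrightarrow> G x) \<and>
     (\<exists>D. D \<in> borel_measurable (lebesgue_on \<Omega>) \<and> integrable (lebesgue_on \<Omega>) (\<lambda>x. D x powr p) \<and>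
        (AE x in lebesgue_on \<Omega>. \<forall>k. norm (grad (\<phi> k) x) \<le> D x))"

text \<open>Apply \<open>L1_null_dominated_subsequence\<close> to the integrands of the \<open>p\<close>-th power of the Sobolev
norm of \<open>u - \<phi>\<^sub>k\<close>.\<close>

lemma W1p_0_dominated_approx:
  assumes \<Omega>: "open \<Omega>" and p: "p > 0" and u: "u \<in> W1p_0 p \<Omega>"
  shows "\<exists>\<phi>. (\<forall>k. \<phi> k \<in> test_functions \<Omega>) \<and> dominated_approx p \<Omega> \<phi> u (weak_grad \<Omega> u)"
proof -
  let ?M = "lebesgue_on \<Omega>"
  obtain \<phi> where \<phi>: "\<And>k. \<phi> k \<in> test_functions \<Omega>" and lim: "(\<lambda>k. W1p_norm p \<Omega> (\<lambda>x. u x - \<phi> k x)) \<longlonglongrightarrow> 0"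
    and u1: "u \<in> W1p p \<Omega>"
    using u unfolding W1p_0_def by blast
  define G where "G = weak_grad \<Omega> u"
  have G: "G \<in> Lp p \<Omega>" "has_weak_gradient \<Omega> u G" using W1p_weak_grad[OF \<Omega> u1] by (auto simp: G_def)
  have uL: "u \<in> Lp p \<Omega>" using u1 by (auto simp: W1p_def)
  define f where "f k x = \<bar>u x - \<phi> k x\<bar> powr p + norm (G x - grad (\<phi> k) x) powr p" for k x
  have L: "(\<lambda>x. u x - \<phi> k x) \<in> Lp p \<Omega>" "(\<lambda>x. G x - grad (\<phi> k) x) \<in> Lp p \<Omega>" for k
    using Lp_diff[OF uL test_function_Lp(1)[OF \<phi> \<Omega> p] p] Lp_diff[OF G(1) test_function_Lp(2)[OF \<phi> \<Omega> p] p] by auto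
  then have i: "integrable ?M (\<lambda>x. \<bar>u x - \<phi> k x\<bar> powr p)" "integrable ?M (\<lambda>x. norm (G x - grad (\<phi> k) x) powr p)" for k
    by (auto simp: Lp_def)
  then have fi: "integrable ?M (f k)" for k by (simp add: f_def[abs_def])
  have sm: "smooth (\<phi> k)" for k using test_functions_smooth[OF \<phi>] .
  have "(\<integral>x. norm (weak_grad \<Omega> (\<lambda>x. u x - \<phi> k x) x) powr p \<partial>?M) = (\<integral>x. norm (G x - grad (\<phi> k) x) powr p \<partial>?M)" for k
  proof (rule integral_cong_AE)
    have ae: "AE x in ?M. weak_grad \<Omega> (\<lambda>x. u x - \<phi> k x) x = G x - grad (\<phi> k) x"
      unfolding G_def by (rule weak_grad_diff_smooth[OF \<Omega> G(2)]) (use sm in blast)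
    then show "AE x in ?M. norm (weak_grad \<Omega> (\<lambda>x. u x - \<phi> k x) x) powr p = norm (G x - grad (\<phi> k) x) powr p"
      by eventually_elim simp
    show "(\<lambda>x. norm (G x - grad (\<phi> k) x) powr p) \<in> borel_measurable ?M" using i(2)[of k] by auto
    have "weak_grad \<Omega> (\<lambda>x. u x - \<phi> k x) \<in> borel_measurable ?M"
    proof (rule borel_measurable_lebesgue_on_AE)
      show "\<Omega> \<in> sets lebesgue" using \<Omega> by auto
      show "(\<lambda>x. G x - grad (\<phi> k) x) \<in> borel_measurable ?M" using L(2)[of k] by (simp add: Lp_def)
      show "AE x in ?M. G x - grad (\<phi> k) x = weak_grad \<Omega> (\<lambda>x. u x - \<phi> k x) x" using ae by eventually_elim simp
    qed
    then show "(\<lambda>x. norm (weak_grad \<Omega> (\<lambda>x. u x - \<phi> k x) x) powr p) \<in> borel_measurable ?M" by measurable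
  qed
  then have "W1p_norm p \<Omega> (\<lambda>x. u x - \<phi> k x) = (\<integral>x. f k x \<partial>?M) powr (1/p)" for k
    unfolding W1p_norm_def f_def using i by simp
  with lim have "(\<lambda>k. (\<integral>x. f k x \<partial>?M) powr (1/p)) \<longlonglongrightarrow> 0" by simp
  then have "(\<lambda>k. ((\<integral>x. f k x \<partial>?M) powr (1/p)) powr p) \<longlonglongrightarrow> 0"
    by (rule tendsto_zero_powrI[OF _ tendsto_const]) (use p in auto)
  moreover have f0: "0 \<le> f k x" for k x by (simp add: f_def)
  ultimately have lim0: "(\<lambda>k. \<integral>x. f k x \<partial>?M) \<longlonglongrightarrow> 0"
    using p by (simp add: powr_powr integral_nonneg_AE)
  obtain r S where rS: "integrable ?M S" "AE x in ?M. (\<lambda>k. f (r k) x) \<longlonglongrightarrow> 0" "AE x in ?M. \<forall>k. f (r k) x \<le> S x"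
    by (rule L1_null_dominated_subsequence[OF fi f0 lim0])
  \<comment> \<open>Undo the \<open>p\<close>-th powers to control the two differences by \<open>f\<close>.\<close>
  have root: "\<bar>s\<bar> \<le> t powr (1/p)" if "\<bar>s\<bar> powr p \<le> t" for s t :: real
  proof -
    have "(\<bar>s\<bar> powr p) powr (1/p) \<le> t powr (1/p)" using that p by (intro powr_mono2) auto
    then show ?thesis using p by (simp add: powr_powr)
  qed
  have tz: "(\<lambda>k. f (r k) x powr (1/p)) \<longlonglongrightarrow> 0" if "(\<lambda>k. f (r k) x) \<longlonglongrightarrow> 0" for x
    by (rule tendsto_zero_powrI[OF that tendsto_const]) (use p f0 in auto)
  have b1: "\<bar>u x - \<phi> k x\<bar> \<le> f k x powr (1/p)" for k x by (rule root) (simp add: f_def)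
  have b2: "norm (G x - grad (\<phi> k) x) \<le> f k x powr (1/p)" for k x
    using root[of "norm (G x - grad (\<phi> k) x)" "f k x"] by (simp add: f_def)
  \<comment> \<open>The majorant: \<open>\<bar>\<nabla>\<phi>\<^sub>k\<bar> \<le> \<bar>G\<bar> + \<bar>G - \<nabla>\<phi>\<^sub>k\<bar>\<close>, and \<open>S\<close> dominates the \<open>p\<close>-th power of the last term.\<close>
  define D where "D x = norm (G x) + \<bar>S x\<bar> powr (1/p)" for x
  have Gm: "G \<in> borel_measurable ?M" "integrable ?M (\<lambda>x. norm (G x) powr p)" using G by (auto simp: Lp_def)
  have Sm: "S \<in> borel_measurable ?M" using rS(1) by auto
  show ?thesis
  proof (intro exI[of _ "\<lambda>k. \<phi> (r k)"] conjI allI)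
    show "\<phi> (r k) \<in> test_functions \<Omega>" for k by (rule \<phi>)
    show "dominated_approx p \<Omega> (\<lambda>k. \<phi> (r k)) u (weak_grad \<Omega> u)"
      unfolding dominated_approx_def G_def[symmetric]
    proof (intro conjI allI exI[of _ D])
      show "Ck m (\<phi> (r k))" for k m using sm by blast
      show "u \<in> borel_measurable ?M" using uL by (simp add: Lp_def)
      show "G \<in> borel_measurable ?M" using Gm(1) .
      show "AE x in ?M. (\<lambda>k. \<phi> (r k) x) \<longlonglongrightarrow> u x"
        using rS(2)
      proof eventually_elim
        case (elim x)
        have "(\<lambda>k. u x - \<phi> (r k) x) \<longlonglongrightarrow> 0"
          by (rule Lim_null_comparison[OF _ tz[OF elim]]) (use b1 in auto)
        from tendsto_diff[OF tendsto_const[of "u x"] this] show ?case by simp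
      qed
      show "AE x in ?M. (\<lambda>k. grad (\<phi> (r k)) x) \<longlonglongrightarrow> G x"
        using rS(2)
      proof eventually_elim
        case (elim x)
        have "(\<lambda>k. G x - grad (\<phi> (r k)) x) \<longlonglongrightarrow> 0"
          by (rule Lim_null_comparison[OF _ tz[OF elim]]) (use b2 in auto)
        from tendsto_diff[OF tendsto_const[of "G x"] this] show ?case by simp
      qed
      show "D \<in> borel_measurable ?M" unfolding D_def using Gm Sm by measurable
      have "(\<lambda>x. (\<bar>S x\<bar> powr (1/p)) powr p) = (\<lambda>x. \<bar>S x\<bar>)" using p by (simp add: powr_powr)
      then show "integrable ?M (\<lambda>x. D x powr p)"
        unfolding D_def using p Gm Sm rS(1) by (intro integrable_powr_add) auto
      show "AE x in ?M. \<forall>k. norm (grad (\<phi> (r k)) x) \<le> D x"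
        using rS(3)
      proof eventually_elim
        case (elim x)
        show ?case
        proof
          fix k
          have "norm (grad (\<phi> (r k)) x) \<le> norm (G x) + norm (G x - grad (\<phi> (r k)) x)"
            by (metis norm_minus_commute norm_triangle_sub)
          moreover have "f (r k) x powr (1/p) \<le> \<bar>S x\<bar> powr (1/p)"
            using elim f0 p by (intro powr_mono2) (auto intro: order_trans)
          ultimately show "norm (grad (\<phi> (r k)) x) \<le> D x" using b2[of x "r k"] by (simp add: D_def)
        qed
      qed
    qed
  qed
qed

section \<open>The flux of the p-Laplacian and the comparison principle\<close>

definition flux :: "real \<Rightarrow> 'a::real_inner \<Rightarrow> 'a" where
  "flux p v = norm v powr (p - 2) *\<^sub>R v"

lemma norm_flux: "norm (flux p v) = norm v powr (p - 1)"
proof (cases "v = 0")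
  case False
  then have "norm v powr (p - 1) = norm v powr (p - 2) * norm v powr 1"
    using powr_add[of "norm v" "p - 2" 1] by simp
  then show ?thesis using False by (simp add: flux_def)
qed (simp add: flux_def)

lemma flux_scaleR:
  assumes "0 \<le> c" shows "flux p (c *\<^sub>R v) = c powr (p - 1) *\<^sub>R flux p v"
proof (cases "c = 0")
  case False
  then have "c powr (p - 1) = c powr (p - 2) * c powr 1"
    using powr_add[of c "p - 2" 1] by simp
  then show ?thesis using assms by (simp add: flux_def powr_mult)
qed (simp add: flux_def)

text \<open>Both summands are nonnegative, the first by monotonicity of powers and the second by the
Cauchy-Schwarz inequality. This form also exhibits the equality case.\<close>

lemma flux_monotone_split:
  "(flux p a - flux p b) \<bullet> (a - b) =
     (norm a powr (p - 1) - norm b powr (p - 1)) * (norm a - norm b) +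
     (norm a powr (p - 2) + norm b powr (p - 2)) * (norm a * norm b - a \<bullet> b)"
proof -
  have e: "norm v powr (p - 1) = norm v powr (p - 2) * norm v" for v :: 'a
    using norm_flux[of p v] by (simp add: flux_def)
  show ?thesis
    unfolding e by (simp add: flux_def inner_diff_left inner_diff_right inner_commute
        power2_norm_eq_inner[symmetric] power2_eq_square algebra_simps)
qed

lemma powr_diff_mult_nonneg:
  fixes x y q :: real
  assumes "0 \<le> x" "0 \<le> y" "0 < q"
  shows "0 \<le> (x powr q - y powr q) * (x - y)"
proof (cases "x \<le> y")
  case True
  then show ?thesis using assms powr_mono2[of q x y] by (simp add: mult_nonpos_nonpos)
next
  case False
  then show ?thesis using assms powr_mono2[of q y x] by simp
qed

lemma flux_monotone:
  assumes "p > 1"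
  shows "0 \<le> (flux p a - flux p b) \<bullet> (a - b)"
  unfolding flux_monotone_split
  using powr_diff_mult_nonneg[of "norm a" "norm b" "p - 1"] norm_cauchy_schwarz[of a b] assms
  by (auto intro!: add_nonneg_nonneg mult_nonneg_nonneg)

lemma flux_strictly_monotone:
  assumes p: "p > 1" and eq: "(flux p a - flux p b) \<bullet> (a - b) = 0"
  shows "a = b"
proof -
  have s: "0 \<le> (norm a powr (p - 1) - norm b powr (p - 1)) * (norm a - norm b)"
    "0 \<le> (norm a powr (p - 2) + norm b powr (p - 2)) * (norm a * norm b - a \<bullet> b)"
    using powr_diff_mult_nonneg[of "norm a" "norm b" "p - 1"] norm_cauchy_schwarz[of a b] p
    by (auto intro!: mult_nonneg_nonneg)
  then have z: "(norm a powr (p - 1) - norm b powr (p - 1)) * (norm a - norm b) = 0"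
    "(norm a powr (p - 2) + norm b powr (p - 2)) * (norm a * norm b - a \<bullet> b) = 0"
    using eq unfolding flux_monotone_split by linarith+
  have n: "norm a = norm b"
  proof (rule ccontr)
    assume "norm a \<noteq> norm b"
    then have "norm a powr (p - 1) = norm b powr (p - 1)" using z(1) by simp
    then show False
      using \<open>norm a \<noteq> norm b\<close> p powr_less_mono2[of "p - 1" "norm a" "norm b"] powr_less_mono2[of "p - 1" "norm b" "norm a"]
      by (cases "norm a < norm b") auto
  qed
  show ?thesis
  proof (cases "a = 0")
    case True
    then show ?thesis using n by simp
  next
    case False
    then have "norm a * norm b = a \<bullet> b" using z(2) n by auto
    moreover have "(norm (a - b))\<^sup>2 = (norm a)\<^sup>2 - 2 * (a \<bullet> b) + (norm b)\<^sup>2"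
      by (simp add: power2_norm_eq_inner inner_diff_left inner_diff_right inner_commute[of b a])
    ultimately have "(norm (a - b))\<^sup>2 = 0" using n by (simp add: power2_eq_square)
    then show ?thesis by simp
  qed
qed

lemma borel_measurable_flux [measurable]:
  fixes G :: "'b \<Rightarrow> 'a::euclidean_space"
  assumes [measurable]: "G \<in> borel_measurable M"
  shows "(\<lambda>x. flux p (G x)) \<in> borel_measurable M"
  unfolding flux_def by measurable

lemma AE_norm_limit_le:
  assumes "AE x in M. (\<lambda>k. g k x) \<longlonglongrightarrow> G x" "AE x in M. \<forall>k. norm (g k x) \<le> D x"
  shows "AE x in M. norm (G x) \<le> D x"
  using assms by eventually_elim (rule Lim_bounded[OF tendsto_norm], auto)

lemma finite_measure_lebesgue_on_bounded:
  fixes \<Omega> :: "'a::euclidean_space set"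
  assumes "open \<Omega>" "\<Omega> \<subseteq> ball 0 R"
  shows "finite_measure (lebesgue_on \<Omega>)"
proof
  have "emeasure lborel \<Omega> < \<infinity>"
    using assms emeasure_bounded_finite bounded_subset[OF bounded_ball] by blast
  then show "emeasure (lebesgue_on \<Omega>) (space (lebesgue_on \<Omega>)) \<noteq> \<infinity>"
    using assms by (simp add: emeasure_restrict_space space_restrict_space)
qed

lemma powr_le_1_plus_powr:
  fixes s q p :: real
  assumes "0 \<le> s" "0 \<le> q" "q \<le> p" shows "s powr q \<le> 1 + s powr p"
proof (cases "s \<le> 1")
  case True
  then have "s powr q \<le> 1" using powr_mono2[of q s 1] assms by simp
  then show ?thesis using powr_ge_zero[of s p] by linarith
next
  case False
  then have "s powr q \<le> s powr p" using assms by (intro powr_mono) auto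
  then show ?thesis by simp
qed

lemma compact_support_bounded:
  assumes f: "continuous_on UNIV f" and K: "compact K" "\<And>x. x \<notin> K \<Longrightarrow> f x = 0"
  shows "\<exists>B>0. \<forall>x. norm (f x) \<le> B"
proof -
  have "continuous_on K f" by (rule continuous_on_subset[OF f]) simp
  then obtain B where B: "B > 0" "\<forall>y\<in>f ` K. norm y \<le> B"
    using compact_imp_bounded[OF compact_continuous_image[OF _ K(1)]] bounded_pos by metis
  have "norm (f x) \<le> B" for x
    by (cases "x \<in> K") (use B K(2)[of x] in auto)
  with B(1) show ?thesis by blast
qed

lemma test_function_grad_bounded:
  assumes "\<psi> \<in> test_functions \<Omega>"
  shows "\<exists>B>0. \<forall>x. norm (grad \<psi> x) \<le> B"
proof -
  obtain K where K: "compact K" "K \<subseteq> \<Omega>" "\<And>x. x \<notin> K \<Longrightarrow> \<psi> x = 0" "\<And>x. x \<notin> K \<Longrightarrow> grad \<psi> x = 0"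
    using test_functionsE[OF assms] by blast
  show ?thesis
    by (rule compact_support_bounded[OF _ K(1) K(4)])
      (use test_functions_smooth[OF assms] C1_continuous_grad[of \<psi>] in blast)
qed

lemma integrable_flux_grad_test:
  fixes G :: "'a::euclidean_space \<Rightarrow> 'a"
  assumes \<Omega>: "open \<Omega>" "\<Omega> \<subseteq> ball 0 R" and p: "p > 1"
    and G: "G \<in> borel_measurable (lebesgue_on \<Omega>)" and D: "D \<in> borel_measurable (lebesgue_on \<Omega>)"
      "integrable (lebesgue_on \<Omega>) (\<lambda>x. D x powr p)" "AE x in lebesgue_on \<Omega>. norm (G x) \<le> D x"
    and \<psi>: "\<psi> \<in> test_functions \<Omega>"
  shows "integrable (lebesgue_on \<Omega>) (\<lambda>x. flux p (G x) \<bullet> grad \<psi> x)"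
proof -
  interpret finite_measure "lebesgue_on \<Omega>" by (rule finite_measure_lebesgue_on_bounded[OF \<Omega>])
  obtain B where B: "B > 0" "\<And>x. norm (grad \<psi> x) \<le> B" using test_function_grad_bounded[OF \<psi>] by blast
  have gm: "grad \<psi> \<in> borel_measurable (lebesgue_on \<Omega>)"
    using test_function_Lp(2)[OF \<psi> \<Omega>(1), of 1] by (simp add: Lp_def)
  show ?thesis
  proof (rule Bochner_Integration.integrable_bound[where f = "\<lambda>x. B * (1 + D x powr p)"])
    show "integrable (lebesgue_on \<Omega>) (\<lambda>x. B * (1 + D x powr p))" using D by simp
    show "(\<lambda>x. flux p (G x) \<bullet> grad \<psi> x) \<in> borel_measurable (lebesgue_on \<Omega>)" using G gm by measurable
    show "AE x in lebesgue_on \<Omega>. norm (flux p (G x) \<bullet> grad \<psi> x) \<le> norm (B * (1 + D x powr p))"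
      using D(3)
    proof eventually_elim
      case (elim x)
      have "norm (flux p (G x) \<bullet> grad \<psi> x) \<le> norm (G x) powr (p - 1) * norm (grad \<psi> x)"
        using Cauchy_Schwarz_ineq2[of "flux p (G x)" "grad \<psi> x"] by (simp add: norm_flux)
      also have "\<dots> \<le> (1 + D x powr p) * B"
      proof (rule mult_mono)
        have "norm (G x) powr (p - 1) \<le> D x powr (p - 1)" using elim p by (intro powr_mono2) auto
        also have "\<dots> \<le> 1 + D x powr p" using elim p norm_ge_zero[of "G x"] by (intro powr_le_1_plus_powr) linarith+
        finally show "norm (G x) powr (p - 1) \<le> 1 + D x powr p" .
      qed (use B in auto)
      finally show ?case using B(1) by (simp add: mult.commute[of B])
    qed
  qed
qed

text \<open>The hypothesis \<open>bdry\<close> encodes \<open>u \<le> v\<close> on the boundary, and \<open>sub\<close> that \<open>- div\<close> of the flux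
of \<open>u\<close> is at most that of \<open>v\<close> in the weak sense. With \<open>\<psi>\<^sub>k = flat 0 (\<phi>\<^sub>k - \<eta>\<^sub>k)\<close> as test
function, the limit of \<open>sub\<close> is an inequality for the integral of
\<open>flat 2 (u - v) (flux G - flux H) \<bullet> (G - H)\<close>, whose integrand is nonnegative; so it
vanishes, and with it the limit of \<open>\<nabla>\<psi>\<^sub>k\<close>.\<close>

lemma weak_comparison:
  fixes \<Omega> :: "'a::euclidean_space set"
  assumes \<Omega>: "open \<Omega>" "\<Omega> \<subseteq> ball 0 R" and p: "p > 1"
    and u: "dominated_approx p \<Omega> \<phi> u G" and v: "dominated_approx p \<Omega> \<eta> v H"
    and bdry: "\<And>k. \<exists>K. compact K \<and> K \<subseteq> \<Omega> \<and> (\<forall>x. x \<notin> K \<longrightarrow> \<phi> k x \<le> \<eta> k x)"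
    and sub: "\<And>\<psi>. \<psi> \<in> test_functions \<Omega> \<Longrightarrow> (\<And>x. 0 \<le> \<psi> x) \<Longrightarrow>
       (\<integral>x. flux p (G x) \<bullet> grad \<psi> x \<partial>lebesgue_on \<Omega>) \<le> (\<integral>x. flux p (H x) \<bullet> grad \<psi> x \<partial>lebesgue_on \<Omega>)"
  shows "AE x in lebesgue_on \<Omega>. u x \<le> v x"
proof -
  let ?M = "lebesgue_on \<Omega>"
  interpret finite_measure ?M by (rule finite_measure_lebesgue_on_bounded[OF \<Omega>])
  have sm: "smooth (\<phi> k)" "smooth (\<eta> k)" for k using u v by (auto simp: dominated_approx_def)
  have mu[measurable]: "u \<in> borel_measurable ?M" "v \<in> borel_measurable ?M" "G \<in> borel_measurable ?M" "H \<in> borel_measurable ?M"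
    using u v by (auto simp: dominated_approx_def)
  have lim: "AE x in ?M. (\<lambda>k. \<phi> k x) \<longlonglongrightarrow> u x" "AE x in ?M. (\<lambda>k. \<eta> k x) \<longlonglongrightarrow> v x"
    "AE x in ?M. (\<lambda>k. grad (\<phi> k) x) \<longlonglongrightarrow> G x" "AE x in ?M. (\<lambda>k. grad (\<eta> k) x) \<longlonglongrightarrow> H x"
    using u v by (auto simp: dominated_approx_def)
  obtain D1 where D1: "D1 \<in> borel_measurable ?M" "integrable ?M (\<lambda>x. D1 x powr p)"
    "AE x in ?M. \<forall>k. norm (grad (\<phi> k) x) \<le> D1 x" using u by (auto simp: dominated_approx_def)
  obtain D2 where D2: "D2 \<in> borel_measurable ?M" "integrable ?M (\<lambda>x. D2 x powr p)"
    "AE x in ?M. \<forall>k. norm (grad (\<eta> k) x) \<le> D2 x" using v by (auto simp: dominated_approx_def)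
  have GD: "AE x in ?M. norm (G x) \<le> D1 x" "AE x in ?M. norm (H x) \<le> D2 x"
    by (rule AE_norm_limit_le[OF lim(3) D1(3)], rule AE_norm_limit_le[OF lim(4) D2(3)])
  define B where "B x = D1 x + D2 x" for x
  have Bm[measurable]: "B \<in> borel_measurable ?M" unfolding B_def using D1 D2 by measurable
  have pos: "AE x in ?M. 0 \<le> D1 x" "AE x in ?M. 0 \<le> D2 x"
    by (rule eventually_mono[OF GD(1)], erule order_trans[OF norm_ge_zero])
      (rule eventually_mono[OF GD(2)], erule order_trans[OF norm_ge_zero])
  have Bp: "integrable ?M (\<lambda>x. B x powr p)"
    unfolding B_def using D1 D2 pos p by (intro integrable_powr_add) auto
  have Bi: "integrable ?M B"
  proof (rule Bochner_Integration.integrable_bound[where f = "\<lambda>x. 1 + B x powr p"])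
    show "AE x in ?M. norm (B x) \<le> norm (1 + B x powr p)"
      using pos
    proof eventually_elim
      case (elim x)
      then show ?case using powr_le_1_plus_powr[of "B x" 1 p] p by (simp add: B_def)
    qed
  qed (use Bp in auto)
  define \<psi> where "\<psi> k x = flat 0 (\<phi> k x - \<eta> k x)" for k x
  have g\<psi>: "grad (\<psi> k) x = flat 2 (\<phi> k x - \<eta> k x) *\<^sub>R (grad (\<phi> k) x - grad (\<eta> k) x)" for k x
  proof -
    have c: "Ck 1 (\<phi> k)" "Ck 1 (\<eta> k)" using sm by blast+
    have "\<psi> k = (\<lambda>x. flat 0 (\<phi> k x - \<eta> k x))" by (simp add: \<psi>_def fun_eq_iff)
    then show ?thesis
      by (simp only: grad_flat_0[OF Ck_diff[OF c]] grad_diff[OF c])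
  qed
  have t\<psi>: "\<psi> k \<in> test_functions \<Omega>" for k
  proof -
    obtain K where K: "compact K" "K \<subseteq> \<Omega>" "\<And>x. x \<notin> K \<Longrightarrow> \<phi> k x \<le> \<eta> k x" using bdry by blast
    show ?thesis
    proof (rule test_functionsI[OF _ K(1,2)])
      show "smooth (\<psi> k)" unfolding \<psi>_def by (intro allI Ck_flat Ck_diff sm[rule_format])
      show "\<psi> k x = 0" if "x \<notin> K" for x using K(3)[OF that] by (simp add: \<psi>_def flat_eq_0_iff)
    qed
  qed
  have \<psi>0: "0 \<le> \<psi> k x" for k x by (simp add: \<psi>_def flat_nonneg)
  have gm[measurable]: "grad (\<psi> k) \<in> borel_measurable ?M" for k
    using test_function_Lp(2)[OF t\<psi> \<Omega>(1), of 1] by (simp add: Lp_def)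
  have \<psi>m[measurable]: "\<psi> k \<in> borel_measurable ?M" for k
    using test_function_Lp(1)[OF t\<psi> \<Omega>(1), of 1] by (simp add: Lp_def)
  have flat_m[measurable]: "flat m \<in> borel_measurable borel" for m
    using flat_continuous by (rule borel_measurable_continuous_onI)
  define W where "W x = flat 2 (u x - v x) *\<^sub>R (G x - H x)" for x
  have Wm[measurable]: "W \<in> borel_measurable ?M" unfolding W_def by measurable
  have g_lim: "AE x in ?M. (\<lambda>k. grad (\<psi> k) x) \<longlonglongrightarrow> W x"
    using lim
  proof eventually_elim
    case (elim x)
    have "(\<lambda>k. flat 2 (\<phi> k x - \<eta> k x)) \<longlonglongrightarrow> flat 2 (u x - v x)"
      by (rule isCont_tendsto_compose[OF DERIV_isCont[OF flat_has_derivative]]) (intro tendsto_intros elim)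
    then show ?case unfolding g\<psi> W_def by (intro tendsto_intros elim)
  qed
  have \<psi>_lim: "AE x in ?M. (\<lambda>k. \<psi> k x) \<longlonglongrightarrow> flat 0 (u x - v x)"
    using lim(1,2)
  proof eventually_elim
    case (elim x)
    show ?case unfolding \<psi>_def
      by (rule isCont_tendsto_compose[OF DERIV_isCont[OF flat_has_derivative]]) (intro tendsto_intros elim)
  qed
  have g_bd: "AE x in ?M. \<forall>k. norm (grad (\<psi> k) x) \<le> 2 * B x"
    using D1(3) D2(3)
  proof eventually_elim
    case (elim x)
    show ?case
    proof
      fix k
      have "norm (grad (\<phi> k) x - grad (\<eta> k) x) \<le> B x"
        using elim norm_triangle_ineq4[of "grad (\<phi> k) x" "grad (\<eta> k) x"]
        by (metis B_def add_mono order_trans)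
      then show "norm (grad (\<psi> k) x) \<le> 2 * B x"
        unfolding g\<psi> by (auto simp: flat_nonneg intro!: mult_mono flat_2_le_2)
    qed
  qed
  define J where "J x = (flux p (G x) - flux p (H x)) \<bullet> W x" for x
  have Jnn: "0 \<le> J x" for x
    unfolding J_def W_def using flux_monotone[OF p, of "G x" "H x"] by (simp add: flat_nonneg)
  have J_lim: "AE x in ?M. (\<lambda>k. (flux p (G x) - flux p (H x)) \<bullet> grad (\<psi> k) x) \<longlonglongrightarrow> J x"
    using g_lim by eventually_elim (auto simp: J_def intro!: tendsto_intros)
  have J_bd: "AE x in ?M. norm ((flux p (G x) - flux p (H x)) \<bullet> grad (\<psi> k) x) \<le> 4 * B x powr p" for k
    using g_bd GD pos
  proof eventually_elim
    case (elim x)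
    have B0: "0 \<le> B x" using elim by (simp add: B_def)
    have "norm (flux p (G x) - flux p (H x)) \<le> norm (G x) powr (p - 1) + norm (H x) powr (p - 1)"
      using norm_triangle_ineq4[of "flux p (G x)" "flux p (H x)"] by (simp add: norm_flux)
    also have "\<dots> \<le> B x powr (p - 1) + B x powr (p - 1)"
      using elim p by (intro add_mono powr_mono2) (auto simp: B_def)
    finally have 1: "norm (flux p (G x) - flux p (H x)) \<le> 2 * B x powr (p - 1)" by simp
    have "norm ((flux p (G x) - flux p (H x)) \<bullet> grad (\<psi> k) x)
       \<le> norm (flux p (G x) - flux p (H x)) * norm (grad (\<psi> k) x)"
      using Cauchy_Schwarz_ineq2 by auto
    also have "\<dots> \<le> (2 * B x powr (p - 1)) * (2 * B x)"
      using 1 elim B0 by (intro mult_mono) auto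
    also have "\<dots> = 4 * B x powr p"
      using B0 powr_mult_base[of "B x" "p - 1"] by (simp add: mult.commute)
    finally show ?case .
  qed
  have ik: "integrable ?M (\<lambda>x. flux p (G x) \<bullet> grad (\<psi> k) x)" "integrable ?M (\<lambda>x. flux p (H x) \<bullet> grad (\<psi> k) x)" for k
    using integrable_flux_grad_test[OF \<Omega> p mu(3) D1(1,2) GD(1) t\<psi>] integrable_flux_grad_test[OF \<Omega> p mu(4) D2(1,2) GD(2) t\<psi>]
    by auto
  have "(\<integral>x. (flux p (G x) - flux p (H x)) \<bullet> grad (\<psi> k) x \<partial>?M) \<le> 0" for k
    using sub[OF t\<psi> \<psi>0] ik by (simp add: inner_diff_left)
  moreover have Jm: "J \<in> borel_measurable ?M" unfolding J_def by measurable
  have Jkm: "(\<lambda>x. (flux p (G x) - flux p (H x)) \<bullet> grad (\<psi> k) x) \<in> borel_measurable ?M" for k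
    by measurable
  have i4: "integrable ?M (\<lambda>x. 4 * B x powr p)" using Bp by simp
  have Ji: "integrable ?M J"
    by (rule integrable_dominated_convergence[OF Jm Jkm i4 J_lim J_bd])
  have Jlim: "(\<lambda>k. \<integral>x. (flux p (G x) - flux p (H x)) \<bullet> grad (\<psi> k) x \<partial>?M) \<longlonglongrightarrow> (\<integral>x. J x \<partial>?M)"
    by (rule integral_dominated_convergence[OF Jm Jkm i4 J_lim J_bd])
  ultimately have "(\<integral>x. J x \<partial>?M) \<le> 0"
    by (intro LIMSEQ_le_const2[OF Jlim]) auto
  then have "(\<integral>x. J x \<partial>?M) = 0" using Jnn by (simp add: antisym)
  then have "AE x in ?M. J x = 0"
    using integral_nonneg_eq_0_iff_AE[OF Ji] Jnn by simp
  \<comment> \<open>Either \<open>u \<le> v\<close>, where \<open>flat 2\<close> vanishes, or the gradients agree by strict monotonicity.\<close>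
  then have W0: "AE x in ?M. W x = 0"
  proof eventually_elim
    case (elim x)
    then have "flat 2 (u x - v x) = 0 \<or> (flux p (G x) - flux p (H x)) \<bullet> (G x - H x) = 0"
      by (simp add: J_def W_def)
    then show ?case using flux_strictly_monotone[OF p] by (auto simp: W_def)
  qed
  have "(\<lambda>k. \<integral>x. norm (grad (\<psi> k) x) \<partial>?M) \<longlonglongrightarrow> (\<integral>x. 0 \<partial>?M)"
  proof (rule integral_dominated_convergence[where w = "\<lambda>x. 2 * B x"])
    show "AE x in ?M. (\<lambda>k. norm (grad (\<psi> k) x)) \<longlonglongrightarrow> 0"
      using g_lim W0 by eventually_elim (auto dest: tendsto_norm)
    show "AE x in ?M. norm (norm (grad (\<psi> k) x)) \<le> 2 * B x" for k
      using g_bd by eventually_elim auto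
    show "(\<lambda>x. norm (grad (\<psi> k) x)) \<in> borel_measurable ?M" for k by measurable
  qed (use Bi in auto)
  then have Rlim: "(\<lambda>k. R * (\<integral>x. norm (grad (\<psi> k) x) \<partial>?M)) \<longlonglongrightarrow> 0"
    by (simp add: tendsto_mult_right_zero)
  have \<psi>lim: "(\<lambda>k. \<integral>x. \<psi> k x \<partial>?M) \<longlonglongrightarrow> (\<integral>x. flat 0 (u x - v x) \<partial>?M)"
  proof (rule integral_dominated_convergence[where w = "\<lambda>x. 1"])
    show "AE x in ?M. norm (\<psi> k x) \<le> 1" for k
      by (intro AE_I2) (simp add: \<psi>_def flat_nonneg flat_0_le_1)
  qed (use \<psi>_lim in auto)
  have "(\<integral>x. flat 0 (u x - v x) \<partial>?M) \<le> 0"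
    by (rule LIMSEQ_le[OF \<psi>lim Rlim]) (use L1_Poincare_test_function[OF t\<psi> \<Omega> \<psi>0] in auto)
  then have "(\<integral>x. flat 0 (u x - v x) \<partial>?M) = 0" by (intro antisym) (auto simp: flat_nonneg)
  moreover have "integrable ?M (\<lambda>x. flat 0 (u x - v x))"
    by (rule integrable_const_bound[of _ 1]) (auto simp: flat_nonneg flat_0_le_1)
  ultimately have "AE x in ?M. flat 0 (u x - v x) = 0"
    by (subst (asm) integral_nonneg_eq_0_iff_AE) (auto simp: flat_nonneg)
  then show ?thesis by eventually_elim (simp add: flat_eq_0_iff)
qed

section \<open>Comparison of solutions and boundedness\<close>

lemma Linf_AE_bound:
  assumes "f \<in> Linf \<Omega>"
  shows "AE x in lebesgue_on \<Omega>. \<bar>f x\<bar> \<le> Linf_norm \<Omega> f"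
proof -
  let ?e = "esssup (lebesgue_on \<Omega>) (\<lambda>x. ennreal \<bar>f x\<bar>)"
  have "?e < \<infinity>" using assms by (simp add: Linf_def)
  then have "?e = ennreal (Linf_norm \<Omega> f)" by (simp add: Linf_norm_def)
  with esssup_AE[of "\<lambda>x. ennreal \<bar>f x\<bar>" "lebesgue_on \<Omega>"]
  have "AE x in lebesgue_on \<Omega>. ennreal \<bar>f x\<bar> \<le> ennreal (Linf_norm \<Omega> f)" by simp
  then show ?thesis
    by eventually_elim (simp add: ennreal_le_iff Linf_norm_def)
qed

lemma Linf_norm_nonneg: "0 \<le> Linf_norm \<Omega> f"
  by (simp add: Linf_norm_def)

lemma Linf_I:
  assumes f: "f \<in> borel_measurable (lebesgue_on \<Omega>)" and b: "AE x in lebesgue_on \<Omega>. \<bar>f x\<bar> \<le> b" "0 \<le> b"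
  shows "f \<in> Linf \<Omega>" "Linf_norm \<Omega> f \<le> b"
proof -
  have "esssup (lebesgue_on \<Omega>) (\<lambda>x. ennreal \<bar>f x\<bar>) \<le> ennreal b"
    using f b by (intro esssup_I) (auto elim!: eventually_mono intro: ennreal_leI)
  then show "f \<in> Linf \<Omega>" "Linf_norm \<Omega> f \<le> b"
    using f b(2) by (auto simp: Linf_def Linf_norm_def le_less_trans[OF _ ennreal_less_top] intro: enn2real_leI)
qed

lemma p_Laplace_solutionD:
  assumes "p_Laplace_solution p \<Omega> f u"
  shows "u \<in> W1p_0 p \<Omega>"
    and "\<psi> \<in> test_functions \<Omega> \<Longrightarrow>
      (\<integral>x. flux p (weak_grad \<Omega> u x) \<bullet> grad \<psi> x \<partial>lebesgue_on \<Omega>) = (\<integral>x. f x * \<psi> x \<partial>lebesgue_on \<Omega>)"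
  using assms by (auto simp: p_Laplace_solution_def flux_def)

text \<open>Scaling is done on the approximants, which avoids computing the chosen weak gradient of a
multiple.\<close>

lemma dominated_approx_cmult:
  assumes c: "0 \<le> c" and p: "p > 0" and u: "dominated_approx p \<Omega> \<phi> u G"
  shows "dominated_approx p \<Omega> (\<lambda>k x. c * \<phi> k x) (\<lambda>x. c * u x) (\<lambda>x. c *\<^sub>R G x)"
proof -
  have sm: "smooth (\<phi> k)" for k using u by (auto simp: dominated_approx_def)
  have m[measurable]: "u \<in> borel_measurable (lebesgue_on \<Omega>)" "G \<in> borel_measurable (lebesgue_on \<Omega>)"
    and lim: "AE x in lebesgue_on \<Omega>. (\<lambda>k. \<phi> k x) \<longlonglongrightarrow> u x" "AE x in lebesgue_on \<Omega>. (\<lambda>k. grad (\<phi> k) x) \<longlonglongrightarrow> G x"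
    using u by (auto simp: dominated_approx_def)
  obtain D where D[measurable]: "D \<in> borel_measurable (lebesgue_on \<Omega>)" and Di: "integrable (lebesgue_on \<Omega>) (\<lambda>x. D x powr p)"
    and Db: "AE x in lebesgue_on \<Omega>. \<forall>k. norm (grad (\<phi> k) x) \<le> D x" using u by (auto simp: dominated_approx_def)
  have g: "grad (\<lambda>x. c * \<phi> k x) x = c *\<^sub>R grad (\<phi> k) x" for k x
    by (rule grad_cmult) (use sm in blast)
  show ?thesis
    unfolding dominated_approx_def g
  proof (intro conjI exI[of _ "\<lambda>x. c * \<bar>D x\<bar>"] allI)
    show "Ck m (\<lambda>x. c * \<phi> k x)" for k m by (intro Ck_mult Ck_const sm[rule_format])
    show "AE x in lebesgue_on \<Omega>. (\<lambda>k. c * \<phi> k x) \<longlonglongrightarrow> c * u x"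
      using lim(1) by eventually_elim (intro tendsto_intros)
    show "AE x in lebesgue_on \<Omega>. (\<lambda>k. c *\<^sub>R grad (\<phi> k) x) \<longlonglongrightarrow> c *\<^sub>R G x"
      using lim(2) by eventually_elim (intro tendsto_intros)
    have "AE x in lebesgue_on \<Omega>. 0 \<le> D x"
      using Db by eventually_elim (use norm_ge_zero order_trans in blast)
    then have "integrable (lebesgue_on \<Omega>) (\<lambda>x. \<bar>D x\<bar> powr p)"
      by (intro integrable_cong_AE_imp[OF Di]) (auto elim!: eventually_mono)
    then show "integrable (lebesgue_on \<Omega>) (\<lambda>x. (c * \<bar>D x\<bar>) powr p)"
      using c by (simp add: powr_mult)
    show "AE x in lebesgue_on \<Omega>. \<forall>k. norm (c *\<^sub>R grad (\<phi> k) x) \<le> c * \<bar>D x\<bar>"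
      using Db
    proof eventually_elim
      case (elim x)
      have "norm (grad (\<phi> k) x) \<le> \<bar>D x\<bar>" for k using elim order_trans[OF _ abs_ge_self] by blast
      then show ?case using c by (simp add: mult_left_mono)
    qed
  qed measurable
qed

lemma integrable_Linf_test:
  assumes \<Omega>: "open \<Omega>" and f: "f \<in> Linf \<Omega>" and \<psi>: "\<psi> \<in> test_functions \<Omega>"
  shows "integrable (lebesgue_on \<Omega>) (\<lambda>x. f x * \<psi> x)"
proof (rule Bochner_Integration.integrable_bound[where f = "\<lambda>x. Linf_norm \<Omega> f * \<bar>\<psi> x\<bar>"])
  have L: "\<psi> \<in> Lp 1 \<Omega>" by (rule test_function_Lp[OF \<psi> \<Omega>]) simp
  then have m[measurable]: "\<psi> \<in> borel_measurable (lebesgue_on \<Omega>)" "f \<in> borel_measurable (lebesgue_on \<Omega>)"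
    using f by (auto simp: Lp_def Linf_def)
  have "(\<lambda>x. \<bar>\<psi> x\<bar> powr 1) = (\<lambda>x. \<bar>\<psi> x\<bar>)" by simp
  then show "integrable (lebesgue_on \<Omega>) (\<lambda>x. Linf_norm \<Omega> f * \<bar>\<psi> x\<bar>)" using L by (simp add: Lp_def)
  show "(\<lambda>x. f x * \<psi> x) \<in> borel_measurable (lebesgue_on \<Omega>)" by measurable
  show "AE x in lebesgue_on \<Omega>. norm (f x * \<psi> x) \<le> norm (Linf_norm \<Omega> f * \<bar>\<psi> x\<bar>)"
    using Linf_AE_bound[OF f] by eventually_elim (auto simp: abs_mult Linf_norm_nonneg intro!: mult_right_mono)
qed

text \<open>The function \<open>c v\<close> solves the equation with right-hand side \<open>c\<^sup>p\<^sup>-\<^sup>1 g\<close>.\<close>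

lemma p_Laplace_comparison:
  fixes \<Omega> :: "'a::euclidean_space set"
  assumes \<Omega>: "open \<Omega>" "\<Omega> \<subseteq> ball 0 R" and p: "p > 1" and c: "0 \<le> c"
    and f: "f \<in> Linf \<Omega>" and g: "g \<in> Linf \<Omega>"
    and u: "p_Laplace_solution p \<Omega> f u" and v: "p_Laplace_solution p \<Omega> g v"
    and le: "AE x in lebesgue_on \<Omega>. f x \<le> c powr (p - 1) * g x"
  shows "AE x in lebesgue_on \<Omega>. u x \<le> c * v x"
proof -
  have p0: "p > 0" using p by simp
  obtain \<phi> where \<phi>: "\<forall>k. \<phi> k \<in> test_functions \<Omega>" "dominated_approx p \<Omega> \<phi> u (weak_grad \<Omega> u)"
    using W1p_0_dominated_approx[OF \<Omega>(1) p0 p_Laplace_solutionD(1)[OF u]] by auto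
  obtain \<eta> where \<eta>: "\<forall>k. \<eta> k \<in> test_functions \<Omega>" "dominated_approx p \<Omega> \<eta> v (weak_grad \<Omega> v)"
    using W1p_0_dominated_approx[OF \<Omega>(1) p0 p_Laplace_solutionD(1)[OF v]] by auto
  show ?thesis
  proof (rule weak_comparison[OF \<Omega> p \<phi>(2) dominated_approx_cmult[OF c p0 \<eta>(2)]])
    fix k
    obtain K1 where K1: "compact K1" "K1 \<subseteq> \<Omega>" "\<And>x. x \<notin> K1 \<Longrightarrow> \<phi> k x = 0" "\<And>x. x \<notin> K1 \<Longrightarrow> grad (\<phi> k) x = 0"
      using test_functionsE[OF \<phi>(1)[rule_format, of k]] by blast
    obtain K2 where K2: "compact K2" "K2 \<subseteq> \<Omega>" "\<And>x. x \<notin> K2 \<Longrightarrow> \<eta> k x = 0" "\<And>x. x \<notin> K2 \<Longrightarrow> grad (\<eta> k) x = 0"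
      using test_functionsE[OF \<eta>(1)[rule_format, of k]] by blast
    show "\<exists>K. compact K \<and> K \<subseteq> \<Omega> \<and> (\<forall>x. x \<notin> K \<longrightarrow> \<phi> k x \<le> c * \<eta> k x)"
      using K1 K2 by (intro exI[of _ "K1 \<union> K2"]) auto
  next
    fix \<psi> assume \<psi>: "\<psi> \<in> test_functions \<Omega>" and pos: "\<And>x. 0 \<le> \<psi> x"
    have "(\<integral>x. f x * \<psi> x \<partial>lebesgue_on \<Omega>) \<le> (\<integral>x. c powr (p - 1) * (g x * \<psi> x) \<partial>lebesgue_on \<Omega>)"
    proof (rule integral_mono_AE)
      show "AE x in lebesgue_on \<Omega>. f x * \<psi> x \<le> c powr (p - 1) * (g x * \<psi> x)"
        using le by eventually_elim (use mult_right_mono[OF _ pos] in \<open>auto simp: mult.assoc[symmetric]\<close>)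
    qed (use integrable_Linf_test[OF \<Omega>(1) _ \<psi>] f g in auto)
    then show "(\<integral>x. flux p (weak_grad \<Omega> u x) \<bullet> grad \<psi> x \<partial>lebesgue_on \<Omega>)
        \<le> (\<integral>x. flux p (c *\<^sub>R weak_grad \<Omega> v x) \<bullet> grad \<psi> x \<partial>lebesgue_on \<Omega>)"
      using p_Laplace_solutionD(2)[OF u \<psi>] p_Laplace_solutionD(2)[OF v \<psi>] by (simp add: flux_scaleR[OF c])
  qed
qed

lemma grad_exp_minus_exp_inner:
  "grad (\<lambda>x. exp (q * (x \<bullet> b - m - exp (x \<bullet> b - m)))) x
     = (q * (1 - exp (x \<bullet> b - m)) * exp (q * (x \<bullet> b - m - exp (x \<bullet> b - m)))) *\<^sub>R b"
  by (rule grad_eqI) (auto intro!: derivative_eq_intros simp: algebra_simps inner_commute[of b])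

lemma grad_exp_exp_inner:
  "grad (\<lambda>x. c * exp (- exp (x \<bullet> b - m))) x = - ((c * exp (x \<bullet> b - m - exp (x \<bullet> b - m))) *\<^sub>R b)"
proof -
  have "exp (x \<bullet> b - m - exp (x \<bullet> b - m)) = exp (x \<bullet> b - m) * exp (- exp (x \<bullet> b - m))"
    by (simp flip: exp_add)
  then show ?thesis
    by (intro grad_eqI) (auto intro!: derivative_eq_intros simp: inner_commute[of b])
qed

text \<open>Compare with the barrier \<open>v = c exp (- exp s)\<close>, \<open>s = x \<bullet> b - m\<close>. It is smooth and positive
on the whole space, decreasing in \<open>s\<close>, and concave for \<open>s < 0\<close>; the shift \<open>m\<close> puts \<open>\<Omega>\<close>
into the range \<open>-2R - 1 \<le> s \<le> -1\<close>. Its flux is \<open>- c\<^sup>p\<^sup>-\<^sup>1 exp ((p - 1) (s - exp s))\<close> times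
\<open>b\<close>, again a smooth field, and minus its divergence is at least \<open>c\<^sup>p\<^sup>-\<^sup>1 \<mu>\<close> on \<open>\<Omega>\<close> with
\<open>\<mu> > 0\<close>. The factor \<open>c\<close> is chosen so that this is \<open>h\<close>.\<close>

lemma p_torsion_bounded:
  fixes \<Omega> :: "'a::euclidean_space set"
  assumes \<Omega>: "open \<Omega>" "\<Omega> \<subseteq> ball 0 R" and p: "p > 1" and h: "0 < h"
  obtains M where "0 < M" "\<And>u. p_Laplace_solution p \<Omega> (\<lambda>_. h) u \<Longrightarrow> AE x in lebesgue_on \<Omega>. u x \<le> M"
proof -
  interpret finite_measure "lebesgue_on \<Omega>" by (rule finite_measure_lebesgue_on_bounded[OF \<Omega>])
  obtain b :: 'a where b: "b \<in> Basis" using nonempty_Basis by blast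
  define m where "m = R + 1"
  define E where "E x = exp ((p - 1) * (x \<bullet> b - m - exp (x \<bullet> b - m)))" for x
  define \<mu> where "\<mu> = (p - 1) * (1 - exp (-1)) * exp ((p - 1) * (- 2 * R - 2))"
  have \<mu>: "0 < \<mu>" using p by (simp add: \<mu>_def)
  define c where "c = (h / \<mu>) powr (1 / (p - 1))"
  have c: "0 < c" "c powr (p - 1) * \<mu> = h" using h \<mu> p by (auto simp: c_def powr_powr)
  define v where "v x = c * exp (- exp (x \<bullet> b - m))" for x
  have smv: "Ck k v" for k
  proof -
    have "v = (\<lambda>x. c * exp (0 - exp (x \<bullet> b - m)))" by (simp add: v_def fun_eq_iff)
    then show ?thesis by (simp only:) (intro Ck_mult Ck_exp Ck_diff Ck_inner Ck_const)
  qed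
  have smE: "Ck k E" for k unfolding E_def by (intro Ck_mult Ck_exp Ck_diff Ck_inner Ck_const)
  have gE: "grad E x = ((p - 1) * (1 - exp (x \<bullet> b - m)) * E x) *\<^sub>R b" for x
    unfolding E_def by (rule grad_exp_minus_exp_inner)
  have gv: "grad v x = - ((c * exp (x \<bullet> b - m - exp (x \<bullet> b - m))) *\<^sub>R b)" for x
    unfolding v_def by (rule grad_exp_exp_inner)
  have fv: "flux p (grad v x) = - ((c powr (p - 1) * E x) *\<^sub>R b)" for x
  proof -
    let ?s = "c * exp (x \<bullet> b - m - exp (x \<bullet> b - m))"
    have "grad v x = ?s *\<^sub>R (- b)" by (simp add: gv)
    then have "flux p (grad v x) = ?s powr (p - 1) *\<^sub>R flux p (- b)"
      using flux_scaleR[of ?s p "- b"] c(1) by simp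
    also have "flux p (- b) = - b" using b by (simp add: flux_def)
    also have "?s powr (p - 1) = c powr (p - 1) * E x"
      using c(1) by (simp add: E_def powr_mult exp_powr_real mult.commute)
    finally show ?thesis by simp
  qed
  have s: "- 2 * R - 1 \<le> x \<bullet> b - m \<and> x \<bullet> b - m \<le> - 1" if "x \<in> \<Omega>" for x
  proof -
    have "norm x < R" using \<Omega>(2) that by auto
    then have "\<bar>x \<bullet> b\<bar> \<le> R" using Basis_le_norm[OF b, of x] by linarith
    then show ?thesis by (auto simp: m_def)
  qed
  have div: "\<mu> \<le> grad E x \<bullet> b" if "x \<in> \<Omega>" for x
  proof -
    let ?t = "exp (x \<bullet> b - m)"
    have e: "?t \<le> exp (-1)" "?t \<le> 1" "exp (-1) \<le> (1::real)" using s[OF that] by simp_all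
    have "- 2 * R - 2 \<le> x \<bullet> b - m - ?t" using s[OF that] e(2) by linarith
    then have m1: "exp ((p - 1) * (- 2 * R - 2)) \<le> E x"
      unfolding E_def exp_le_cancel_iff using p by (intro mult_left_mono) simp_all
    have m2: "(p - 1) * (1 - exp (-1)) \<le> (p - 1) * (1 - ?t)"
      using e(1) p by (intro mult_left_mono) simp_all
    have m3: "0 \<le> (p - 1) * (1 - ?t)" using e(2) p by simp
    have "\<mu> \<le> (p - 1) * (1 - ?t) * E x"
      unfolding \<mu>_def by (rule mult_mono[OF m2 m1 m3]) simp
    moreover have "grad E x \<bullet> b = (p - 1) * (1 - ?t) * E x"
      using b by (simp only: gE inner_scaleR_left inner_same_Basis mult_1_right)
    ultimately show ?thesis by simp
  qed
  have cgv: "continuous_on UNIV (grad v)" using C1_continuous_grad[OF smv] .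
  have cv: "continuous_on UNIV v" by (rule smooth_continuous) (intro allI smv)
  have mv: "v \<in> borel_measurable (lebesgue_on \<Omega>)" "grad v \<in> borel_measurable (lebesgue_on \<Omega>)"
    using borel_measurable_continuous_onI[OF cv] borel_measurable_continuous_onI[OF cgv]
    by (simp_all add: measurable_restrict_space1 measurable_completion)
  have v_le: "v x \<le> c" for x using c(1) by (simp add: v_def)
  have nE: "norm (grad v x) \<le> c" for x
  proof -
    have "x \<bullet> b - m - exp (x \<bullet> b - m) \<le> 0" using exp_ge_add_one_self[of "x \<bullet> b - m"] by linarith
    then show ?thesis using b c(1) by (simp add: gv)
  qed
  have dv: "dominated_approx p \<Omega> (\<lambda>_. v) v (grad v)"
    unfolding dominated_approx_def
    by (intro conjI exI[of _ "\<lambda>_. c"] allI AE_I2 tendsto_const smv mv nE) simp_all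
  show ?thesis
  proof
    show "0 < c" by fact
    fix u assume u: "p_Laplace_solution p \<Omega> (\<lambda>_. h) u"
    have p0: "p > 0" using p by simp
    obtain \<phi> where \<phi>: "\<forall>k. \<phi> k \<in> test_functions \<Omega>" "dominated_approx p \<Omega> \<phi> u (weak_grad \<Omega> u)"
      using W1p_0_dominated_approx[OF \<Omega>(1) p0 p_Laplace_solutionD(1)[OF u]] by auto
    have "AE x in lebesgue_on \<Omega>. u x \<le> v x"
    proof (rule weak_comparison[OF \<Omega> p \<phi>(2) dv])
      fix k
      obtain K1 where K1: "compact K1" "K1 \<subseteq> \<Omega>" "\<And>x. x \<notin> K1 \<Longrightarrow> \<phi> k x = 0" "\<And>x. x \<notin> K1 \<Longrightarrow> grad (\<phi> k) x = 0"
        using test_functionsE[OF \<phi>(1)[rule_format, of k]] by blast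
      then show "\<exists>K. compact K \<and> K \<subseteq> \<Omega> \<and> (\<forall>x. x \<notin> K \<longrightarrow> \<phi> k x \<le> v x)"
        using c(1) by (intro exI[of _ K1]) (auto simp: v_def)
    next
      fix \<psi> assume \<psi>: "\<psi> \<in> test_functions \<Omega>" and pos: "\<And>x. 0 \<le> \<psi> x"
      obtain K where K: "compact K" "K \<subseteq> \<Omega>" "\<And>x. x \<notin> K \<Longrightarrow> \<psi> x = 0" "\<And>x. x \<notin> K \<Longrightarrow> grad \<psi> x = 0"
        using test_functionsE[OF \<psi>] by blast
      have c\<psi>: "continuous_on UNIV \<psi>" using smooth_continuous test_functions_smooth[OF \<psi>] by blast
      have cE: "continuous_on UNIV (\<lambda>x. \<psi> x * (grad E x \<bullet> b))"
        using C1_continuous_grad[OF smE] c\<psi> by (intro continuous_intros)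
      have "(\<integral>x. flux p (weak_grad \<Omega> u x) \<bullet> grad \<psi> x \<partial>lebesgue_on \<Omega>) = (\<integral>x. h * \<psi> x \<partial>lebesgue_on \<Omega>)"
        by (rule p_Laplace_solutionD(2)[OF u \<psi>])
      also have "\<dots> \<le> (\<integral>x. c powr (p - 1) * (\<psi> x * (grad E x \<bullet> b)) \<partial>lebesgue_on \<Omega>)"
      proof (rule integral_mono)
        show "integrable (lebesgue_on \<Omega>) (\<lambda>x. h * \<psi> x)"
          using compact_support_integrable[OF c\<psi> K(1,2,3) \<Omega>(1)] by simp
        show "integrable (lebesgue_on \<Omega>) (\<lambda>x. c powr (p - 1) * (\<psi> x * (grad E x \<bullet> b)))"
          using compact_support_integrable[OF cE K(1,2) _ \<Omega>(1)] K(3) by simp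
        fix x assume "x \<in> space (lebesgue_on \<Omega>)"
        then have "\<mu> \<le> grad E x \<bullet> b" using div by (simp add: space_restrict_space)
        then have "c powr (p - 1) * \<mu> * \<psi> x \<le> c powr (p - 1) * (grad E x \<bullet> b) * \<psi> x"
          using pos by (intro mult_right_mono mult_left_mono) auto
        then show "h * \<psi> x \<le> c powr (p - 1) * (\<psi> x * (grad E x \<bullet> b))"
          unfolding c(2) by (simp add: mult_ac)
      qed
      also have "\<dots> = - (c powr (p - 1) * (\<integral>x. E x * (grad \<psi> x \<bullet> b) \<partial>lebesgue_on \<Omega>))"
        unfolding integration_by_parts[OF smE \<psi> \<Omega>(1) b] by simp
      also have "\<dots> = (\<integral>x. flux p (grad v x) \<bullet> grad \<psi> x \<partial>lebesgue_on \<Omega>)"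
        unfolding fv by (simp add: inner_commute[of b] mult.assoc)
      finally show "(\<integral>x. flux p (weak_grad \<Omega> u x) \<bullet> grad \<psi> x \<partial>lebesgue_on \<Omega>)
        \<le> (\<integral>x. flux p (grad v x) \<bullet> grad \<psi> x \<partial>lebesgue_on \<Omega>)" .
    qed
    then show "AE x in lebesgue_on \<Omega>. u x \<le> c"
      by eventually_elim (use v_le order_trans in blast)
  qed
qed

section \<open>The stability estimate\<close>

text \<open>Since \<open>0 < 1/p < 1\<close>, one has \<open>(1 + t)\<^bsup>1/p\<^esup> \<le> 1 + t\<close> and, for \<open>t < 1\<close>,
\<open>(1 - t)\<^bsup>1/p\<^esup> \<ge> 1 - t\<close>. For \<open>t \<ge> 1\<close> the lower bound on \<open>s\<^sup>q\<close> is trivial.\<close>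

lemma powr_diff_le_if_relative_bounds:
  fixes p t s w :: real
  assumes p: "p > 1" and s: "0 < s" and w: "0 < w" and t: "0 \<le> t"
    and upper: "s \<le> (1 + t) powr (1 / (p - 1)) * w"
    and lower: "t < 1 \<Longrightarrow> (1 - t) powr (1 / (p - 1)) * w \<le> s"
  shows "\<bar>s powr ((p - 1) / p) - w powr ((p - 1) / p)\<bar> \<le> t * w powr ((p - 1) / p)"
proof -
  let ?q = "(p - 1) / p"
  have q: "0 < ?q" using p by simp
  have scale: "(r powr (1 / (p - 1)) * w) powr ?q = r powr (1 / p) * w powr ?q" for r
    using p w by (simp add: powr_mult powr_powr)
  have "s powr ?q \<le> ((1 + t) powr (1 / (p - 1)) * w) powr ?q"
    using upper s q by (intro powr_mono2) auto
  also have "\<dots> = (1 + t) powr (1 / p) * w powr ?q" by (rule scale)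
  also have "\<dots> \<le> (1 + t) * w powr ?q"
    using powr_mono[of "1 / p" 1 "1 + t"] t p by (intro mult_right_mono) auto
  finally have u: "s powr ?q \<le> (1 + t) * w powr ?q" .
  have l: "(1 - t) * w powr ?q \<le> s powr ?q"
  proof (cases "t < 1")
    case True
    have "(1 - t) * w powr ?q \<le> (1 - t) powr (1 / p) * w powr ?q"
      using powr_mono'[of "1 / p" 1 "1 - t"] t p True by (intro mult_right_mono) auto
    also have "\<dots> = ((1 - t) powr (1 / (p - 1)) * w) powr ?q" by (rule scale[symmetric])
    also have "\<dots> \<le> s powr ?q"
      using lower[OF True] w q by (intro powr_mono2) auto
    finally show ?thesis .
  next
    case False
    then have "(1 - t) * w powr ?q \<le> 0" by (intro mult_nonpos_nonneg) auto
    then show ?thesis using powr_ge_zero[of s ?q] by linarith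
  qed
  show ?thesis using u l by (simp add: algebra_simps abs_le_iff)
qed

text \<open>Two comparisons with multiples of the other solution: the first bounds \<open>u\<close> by a multiple
of \<open>w\<close>, the second \<open>w\<close> by a multiple of \<open>u\<close>, so that in both the factor is applied to the
larger function.\<close>

lemma p_Laplace_relative_stability:
  fixes \<Omega> :: "'a::euclidean_space set"
  assumes \<Omega>: "open \<Omega>" "\<Omega> \<subseteq> ball 0 R" and p: "p > 1" and h: "0 < h" and a: "a \<in> Linf \<Omega>"
    and w: "p_Laplace_solution p \<Omega> (\<lambda>_. h) w" "AE x in lebesgue_on \<Omega>. 0 < w x"
    and u: "p_Laplace_solution p \<Omega> a u" "AE x in lebesgue_on \<Omega>. 0 < u x"
    and t: "0 \<le> t" "AE x in lebesgue_on \<Omega>. \<bar>a x - h\<bar> \<le> t * h"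
  shows "AE x in lebesgue_on \<Omega>. \<bar>u x powr ((p - 1) / p) - w x powr ((p - 1) / p)\<bar> \<le> t * w x powr ((p - 1) / p)"
proof -
  have hL: "(\<lambda>_. h) \<in> Linf \<Omega>" by (rule Linf_I[where b = h]) (use h in auto)
  have upper: "AE x in lebesgue_on \<Omega>. u x \<le> (1 + t) powr (1 / (p - 1)) * w x"
  proof (rule p_Laplace_comparison[OF \<Omega> p _ a hL u(1) w(1)])
    have c: "((1 + t) powr (1 / (p - 1))) powr (p - 1) = 1 + t" using p t(1) by (simp add: powr_powr)
    show "AE x in lebesgue_on \<Omega>. a x \<le> ((1 + t) powr (1 / (p - 1))) powr (p - 1) * h"
      unfolding c using t(2) by eventually_elim (simp add: algebra_simps)
  qed simp
  have lower: "AE x in lebesgue_on \<Omega>. t < 1 \<longrightarrow> (1 - t) powr (1 / (p - 1)) * w x \<le> u x"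
  proof (cases "t < 1")
    case True
    let ?c = "(1 / (1 - t)) powr (1 / (p - 1))"
    have "AE x in lebesgue_on \<Omega>. w x \<le> ?c * u x"
    proof (rule p_Laplace_comparison[OF \<Omega> p _ hL a w(1) u(1)])
      have c: "?c powr (p - 1) = 1 / (1 - t)" using p True by (simp add: powr_powr)
      show "AE x in lebesgue_on \<Omega>. h \<le> ?c powr (p - 1) * a x"
        unfolding c using t(2)
      proof eventually_elim
        case (elim x)
        then have "h * (1 - t) \<le> a x" by (simp add: algebra_simps)
        then show ?case using True by (simp add: pos_le_divide_eq)
      qed
    qed simp
    then show ?thesis
    proof eventually_elim
      case (elim x)
      then have "(1 - t) powr (1 / (p - 1)) * w x \<le> (1 - t) powr (1 / (p - 1)) * (?c * u x)"
        by (intro mult_left_mono) auto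
      also have "\<dots> = u x" using True by (simp add: powr_divide)
      finally show ?case by simp
    qed
  qed simp
  show ?thesis
    using upper lower w(2) u(2) by eventually_elim (rule powr_diff_le_if_relative_bounds[OF p _ _ t(1)]; simp)
qed

theorem theorem1p8:
  fixes p :: real
  assumes "CARD('n::finite) \<ge> 2" and "p > 1"
  shows "\<exists>\<kappa> :: real \<Rightarrow> real. (\<forall>\<beta>\<in>{0<..1}. 0 < \<kappa> \<beta> \<and> \<kappa> \<beta> < 1) \<and>
    (\<forall>(\<Omega> :: (real ^ 'n) set) (\<alpha> :: real) (a_inf :: real) (A :: real).
       open \<Omega> \<and> bounded \<Omega> \<and> convex \<Omega> \<and> 0 < \<alpha> \<and> \<alpha> < 1 \<and> C1_alpha_boundary \<alpha> \<Omega> \<and> 0 < a_inf \<longrightarrow>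
       (\<exists>C>0. \<forall>\<beta>\<in>{0<..1}. \<forall>a u u_inf.
          a \<in> Linf \<Omega> \<and> Linf_norm \<Omega> a = A \<and>
          p_Laplace_solution p \<Omega> (\<lambda>_. a_inf) u_inf \<and> (AE x in lebesgue_on \<Omega>. u_inf x > 0) \<and>
          p_Laplace_solution p \<Omega> a u \<and> (\<forall>x\<in>\<Omega>. u x > 0) \<and> Holder_on \<beta> (closure \<Omega>) u \<longrightarrow>
          (\<lambda>x. u x powr ((p - 1) / p) - u_inf x powr ((p - 1) / p)) \<in> Linf \<Omega> \<and>
          Linf_norm \<Omega> (\<lambda>x. u x powr ((p - 1) / p) - u_inf x powr ((p - 1) / p))
            \<le> C * Linf_norm \<Omega> (\<lambda>x. a x - a_inf) powr \<kappa> \<beta>))"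
proof (intro exI[of _ "\<lambda>_. 1/2"] conjI allI impI)
  fix \<Omega> :: "(real ^ 'n) set" and \<alpha> h A :: real
  assume "open \<Omega> \<and> bounded \<Omega> \<and> convex \<Omega> \<and> 0 < \<alpha> \<and> \<alpha> < 1 \<and> C1_alpha_boundary \<alpha> \<Omega> \<and> 0 < h"
  then have \<Omega>: "open \<Omega>" "bounded \<Omega>" and h: "0 < h" by auto
  obtain R where R: "\<Omega> \<subseteq> ball 0 R" using bounded_subset_ballD[OF \<Omega>(2)] by blast
  obtain M where M: "0 < M" "\<And>w. p_Laplace_solution p \<Omega> (\<lambda>_. h) w \<Longrightarrow> AE x in lebesgue_on \<Omega>. w x \<le> M"
    using p_torsion_bounded[OF \<Omega>(1) R assms(2) h] by blast
  let ?q = "(p - 1) / p"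
  define C where "C = M powr ?q / h * (\<bar>A\<bar> + h) powr (1/2)"
  have "0 < C" using M h by (auto simp: C_def intro!: mult_pos_pos divide_pos_pos)
  moreover have "(\<lambda>x. u x powr ?q - w x powr ?q) \<in> Linf \<Omega> \<and>
      Linf_norm \<Omega> (\<lambda>x. u x powr ?q - w x powr ?q) \<le> C * Linf_norm \<Omega> (\<lambda>x. a x - h) powr (1/2)"
    if a: "a \<in> Linf \<Omega>" "Linf_norm \<Omega> a = A"
      and w: "p_Laplace_solution p \<Omega> (\<lambda>_. h) w" "AE x in lebesgue_on \<Omega>. w x > 0"
      and u: "p_Laplace_solution p \<Omega> a u" "\<forall>x\<in>\<Omega>. u x > 0" for a u w
  proof -
    define \<delta> where "\<delta> = Linf_norm \<Omega> (\<lambda>x. a x - h)"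
    have am[measurable]: "a \<in> borel_measurable (lebesgue_on \<Omega>)" using a(1) by (simp add: Linf_def)
    have "AE x in lebesgue_on \<Omega>. \<bar>a x - h\<bar> \<le> \<bar>A\<bar> + h"
      using Linf_AE_bound[OF a(1)] unfolding a(2) by eventually_elim (use h in auto)
    then have d: "(\<lambda>x. a x - h) \<in> Linf \<Omega>" "\<delta> \<le> \<bar>A\<bar> + h"
      using Linf_I[of "\<lambda>x. a x - h" \<Omega> "\<bar>A\<bar> + h"] h by (simp_all add: \<delta>_def)
    have \<delta>0: "0 \<le> \<delta>" by (simp add: \<delta>_def Linf_norm_nonneg)
    have close: "AE x in lebesgue_on \<Omega>. \<bar>a x - h\<bar> \<le> \<delta> / h * h"
      using Linf_AE_bound[OF d(1)] h by (simp add: \<delta>_def)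
    have pos: "AE x in lebesgue_on \<Omega>. 0 < u x"
      using u(2) by (intro AE_I2) (simp add: space_restrict_space)
    have rel: "AE x in lebesgue_on \<Omega>. \<bar>u x powr ?q - w x powr ?q\<bar> \<le> \<delta> / h * w x powr ?q"
      by (rule p_Laplace_relative_stability[OF \<Omega>(1) R assms(2) h a(1) w u(1) pos _ close]) (use \<delta>0 h in simp)
    have bound: "AE x in lebesgue_on \<Omega>. \<bar>u x powr ?q - w x powr ?q\<bar> \<le> \<delta> / h * M powr ?q"
      using rel M(2)[OF w(1)] w(2)
    proof eventually_elim
      case (elim x)
      have "w x powr ?q \<le> M powr ?q" using elim assms(2) by (intro powr_mono2) auto
      then have "\<delta> / h * w x powr ?q \<le> \<delta> / h * M powr ?q" using \<delta>0 h by (intro mult_left_mono) auto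
      with elim(1) show ?case by linarith
    qed
    have m[measurable]: "u \<in> borel_measurable (lebesgue_on \<Omega>)" "w \<in> borel_measurable (lebesgue_on \<Omega>)"
      using p_Laplace_solutionD(1)[OF u(1)] p_Laplace_solutionD(1)[OF w(1)]
      by (auto simp: W1p_0_def W1p_def Lp_def)
    have meas: "(\<lambda>x. u x powr ?q - w x powr ?q) \<in> borel_measurable (lebesgue_on \<Omega>)" by measurable
    have nn: "0 \<le> \<delta> / h * M powr ?q" using \<delta>0 h by simp
    \<comment> \<open>Trade one factor \<open>\<delta>\<^bsup>1/2\<^esup>\<close> for the a priori bound on \<open>\<delta>\<close>.\<close>
    have "\<delta> = \<delta> powr (1/2) * \<delta> powr (1/2)"
      using \<delta>0 by (cases "\<delta> = 0") (auto simp flip: powr_add)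
    also have "\<dots> \<le> (\<bar>A\<bar> + h) powr (1/2) * \<delta> powr (1/2)"
      using d(2) \<delta>0 by (intro mult_right_mono powr_mono2) auto
    finally have "M powr ?q / h * \<delta> \<le> M powr ?q / h * ((\<bar>A\<bar> + h) powr (1/2) * \<delta> powr (1/2))"
      using h by (intro mult_left_mono) auto
    then have "\<delta> / h * M powr ?q \<le> C * \<delta> powr (1/2)"
      unfolding C_def by (simp add: mult_ac)
    then show ?thesis
      using Linf_I[OF meas bound nn] unfolding \<delta>_def[symmetric] by linarith
  qed
  ultimately show "\<exists>C>0. \<forall>\<beta>\<in>{0<..1}. \<forall>a u u_inf.
          a \<in> Linf \<Omega> \<and> Linf_norm \<Omega> a = A \<and>
          p_Laplace_solution p \<Omega> (\<lambda>_. h) u_inf \<and> (AE x in lebesgue_on \<Omega>. u_inf x > 0) \<and>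
          p_Laplace_solution p \<Omega> a u \<and> (\<forall>x\<in>\<Omega>. u x > 0) \<and> Holder_on \<beta> (closure \<Omega>) u \<longrightarrow>
          (\<lambda>x. u x powr ((p - 1) / p) - u_inf x powr ((p - 1) / p)) \<in> Linf \<Omega> \<and>
          Linf_norm \<Omega> (\<lambda>x. u x powr ((p - 1) / p) - u_inf x powr ((p - 1) / p))
            \<le> C * Linf_norm \<Omega> (\<lambda>x. a x - h) powr (1/2)"
    by (intro exI[of _ C]) blast
qed simp

end
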